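(* Let $X$ be a uniformly perfect complete doubling metric space. Then for each $\varepsilon>0$ there exists a doubling measure $\mu$ supported on $X$ such that $\underline{\dim}_{\mathrm{reg}}(\mu) > \underline{\dim}_{\mathrm A}(X)-\varepsilon$.
   Context: Let $X=(X,d)$ be a metric space, always assumed to contain at least two points. Balls are closed: $B(x,r)=\{y\in X: d(x,y)\le r\}$; for $B=B(x,r)$ write $2B=B(x,2r)$. Doubling metric space: there is $N\in\mathbb N$ such that every ball $B(x,2r)\subset X$ can be covered by at most $N$ balls of radius $r$. Uniformly perfect: there is a constant $C\ge 1$ such that for every $x\in X$ and $r>0$ one has $B(x,r)\setminus B(x,r/C)\ne\emptyset$ whenever $X\setminus B(x,r)\neq\emptyset$. Lower dimension $\underline{\dim}_{\mathrm A}(X)$: the supremum of all $t\ge 0$ for which there is a constant $c>0$ such that, whenever $0<r<R<\operatorname{diam}(X)$ and $x\in X$, at least $c(r/R)^{-t}$ balls of radius $r$ are needed to cover $B(x,R)$. Measure: a nontrivial Borel regular outer measure on $X$ for which bounded sets have finite measure. A measure $\mu$ is supported on $X$ if its support is the whole of $X$, i.e. every ball of positive radius has positive measure. A measure $\mu$ is doubling if there is a constant $C\ge1$ such that $0<\mu(2B)\le C\mu(B)$ for all closed balls $B$ of $X$. Lower regularity dimension $\underline{\dim}_{\mathrm{reg}}(\mu)$ (for $\mu$ supported on $X$): the supremum of all $t\ge0$ for which there is a constant $C\ge1$ such that $\frac{\mu(B(x,r))}{\mu(B(x,R))}\le C\left(\frac rR\right)^t$ whenever $x\in X$ and $0<r<R<\operatorname{diam}(X)$.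 *)

theory Defs
  imports "HOL-Analysis.Analysis"
begin

text \<open>
  The metric space \<open>X\<close> is the whole type \<open>'a\<close>. Balls are closed, have positive radius, and are
  indexed by centre and radius.
\<close>

definition covered_by_balls :: "'a::metric_space set \<Rightarrow> real \<Rightarrow> 'a set \<Rightarrow> bool" where
  "covered_by_balls A r F \<longleftrightarrow> A \<subseteq> (\<Union>y\<in>F. cball y r)"

definition doubling_space :: "'a::metric_space itself \<Rightarrow> bool" where
  "doubling_space TYPE('a) \<longleftrightarrow>
    (\<exists>N::nat. \<forall>(x::'a) r. 0 < r \<longrightarrow>
      (\<exists>F. finite F \<and> card F \<le> N \<and> covered_by_balls (cball x (2 * r)) r F))"

definition uniformly_perfect :: "'a::metric_space itself \<Rightarrow> bool" where
  "uniformly_perfect TYPE('a) \<longleftrightarrow>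
    (\<exists>C::real. 1 \<le> C \<and>
      (\<forall>(x::'a) r. 0 < r \<longrightarrow> UNIV - cball x r \<noteq> {} \<longrightarrow> cball x r - cball x (r / C) \<noteq> {}))"

text \<open>
  The library's \<open>diameter\<close> is real-valued and is \<open>0\<close> on unbounded sets; here an unbounded space has
  diameter \<open>\<infinity>\<close>.
\<close>

definition ediameter :: "'a::metric_space set \<Rightarrow> ereal" where
  "ediameter S = (SUP (x, y) \<in> S \<times> S. ereal (dist x y))"

text \<open>
  Counting centres instead of balls does not change the least number of balls in a cover. Infinite
  families satisfy every lower bound, so only finite ones are tested.
\<close>

definition lower_dimension :: "'a::metric_space itself \<Rightarrow> ereal" where
  "lower_dimension TYPE('a) =
    Sup {ereal t | t. 0 \<le> t \<and>
      (\<exists>c>0. \<forall>(x::'a) r R. 0 < r \<longrightarrow> r < R \<longrightarrow> ereal R < ediameter (UNIV :: 'a set) \<longrightarrow>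
        (\<forall>F. finite F \<longrightarrow> covered_by_balls (cball x R) r F \<longrightarrow>
          c * (r / R) powr (- t) \<le> real (card F)))}"

text \<open>
  In \<open>measure_on_space\<close>, \<open>lambda_system UNIV UNIV \<mu>\<close> is the family of all Caratheodory-measurable
  sets, the second \<open>UNIV\<close> being the power set of the space.
\<close>

definition measure_on_space :: "('a::metric_space set \<Rightarrow> ennreal) \<Rightarrow> bool" where
  "measure_on_space \<mu> \<longleftrightarrow>
    outer_measure_space UNIV \<mu> \<and>
    sets borel \<subseteq> lambda_system UNIV UNIV \<mu> \<and>
    (\<forall>A. \<exists>B\<in>sets borel. A \<subseteq> B \<and> \<mu> B = \<mu> A) \<and>
    (\<exists>A. \<mu> A \<noteq> 0) \<and>
    (\<forall>A. bounded A \<longrightarrow> \<mu> A < \<infinity>)"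

definition fully_supported :: "('a::metric_space set \<Rightarrow> ennreal) \<Rightarrow> bool" where
  "fully_supported \<mu> \<longleftrightarrow> (\<forall>x r. 0 < r \<longrightarrow> 0 < \<mu> (cball x r))"

definition doubling_measure :: "('a::metric_space set \<Rightarrow> ennreal) \<Rightarrow> bool" where
  "doubling_measure \<mu> \<longleftrightarrow> measure_on_space \<mu> \<and>
    (\<exists>C::real. 1 \<le> C \<and>
      (\<forall>x r. 0 < r \<longrightarrow>
        0 < \<mu> (cball x (2 * r)) \<and> \<mu> (cball x (2 * r)) \<le> ennreal C * \<mu> (cball x r)))"

definition lower_regularity_dimension :: "('a::metric_space set \<Rightarrow> ennreal) \<Rightarrow> ereal" where
  "lower_regularity_dimension \<mu> =
    Sup {ereal t | t. 0 \<le> t \<and>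
      (\<exists>C::real. 1 \<le> C \<and>
        (\<forall>x r R. 0 < r \<longrightarrow> r < R \<longrightarrow> ereal R < ediameter (UNIV :: 'a set) \<longrightarrow>
          \<mu> (cball x r) / \<mu> (cball x R) \<le> ennreal (C * (r / R) powr t)))}"

end

(* Fix maximal d^n-separated nets T n for n in Z, all containing a base point b, and let the parent of
   a point of T n be a nearby point of T (n - 1), the close one if there is one. Distribute mass down
   the resulting tree: children far from the centre of their parent each get the same small fraction
   p of its mass, and the children near the centre share the rest equally. If t is slightly below the
   lower dimension and s < t, then for small d there are at least d^(-s) central children, so every
   fraction is at most d^s; this gives the decay of the measure of balls. The measure is doubling
   because two nearby points with different parents are both peripheral, so that their masses
   relative to their parents agree. The measure itself is the image of Lebesgue measure under the
   map sending a number to the limit of the nodes whose intervals contain it. *)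
theory Submission
  imports Defs
begin

section \<open>Weighted trees with two-sided levels\<close>

text \<open>Balls of every radius must be controlled and \<open>X\<close> may be unbounded, so the
  tree has no root at which a total mass could be fixed. The line of copies of \<open>b\<close>
  replaces it: all lines of ancestors end in it, and values prescribed along it determine the rest.
  The obstacle is doubling. Two nearby points can have different parents for arbitrarily many
  levels, and a bounded change of their mass ratio at each level would compound without limit. With
  equal fractions the ratio stays put until the lines merge, and one factor \<open>p\<close> is lost
  there. In units of the parent scale, the centre has radius 1/4 while a parent within 1/2 is
  forced; this gap gives every neighbour of a central child the same parent. The fraction
  \<open>p\<close> has two upper bounds: \<open>\<delta> powr s\<close>, for the decay, and the
  reciprocal of a count of nodes in a ball, so that central children receive at least
  \<open>p\<close> as well. The lower dimension says nothing beyond the diameter; at such coarse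
  scales only the bound 1 for a fraction remains.\<close>

primrec ancestor :: "(int \<Rightarrow> 'a \<Rightarrow> 'a) \<Rightarrow> nat \<Rightarrow> int \<Rightarrow> 'a \<Rightarrow> 'a" where
  "ancestor par 0 n y = y"
| "ancestor par (Suc k) n y = ancestor par k (n - 1) (par n y)"

lemma ancestor_Suc: "ancestor par (Suc k) n y = par (n - int k) (ancestor par k n y)"
proof (induction k arbitrary: n y)
  case (Suc k)
  have "ancestor par (Suc (Suc k)) n y = par (n - 1 - int k) (ancestor par k (n - 1) (par n y))"
    using Suc.IH[of "n - 1" "par n y"] by simp
  then show ?case by (simp add: algebra_simps)
qed simp

text \<open>Smaller indices are coarser levels. In the absence of a lowest level,
  \<open>ancestor_base\<close> allows induction on the number of steps up to a common
  ancestor.\<close>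

locale level_tree =
  fixes T :: "int \<Rightarrow> 'a set" and par :: "int \<Rightarrow> 'a \<Rightarrow> 'a" and b :: 'a
  assumes base_in: "b \<in> T n"
    and par_base: "par n b = b"
    and par_in: "y \<in> T n \<Longrightarrow> par n y \<in> T (n - 1)"
    and ancestor_base: "y \<in> T n \<Longrightarrow> \<exists>k. ancestor par k n y = b"
    and finite_children: "z \<in> T (n - 1) \<Longrightarrow> finite {y \<in> T n. par n y = z}"
    and countable_level: "countable (T n)"
begin

lemma ancestor_in: "y \<in> T n \<Longrightarrow> ancestor par k n y \<in> T (n - int k)"
proof (induction k arbitrary: n y)
  case (Suc k)
  show ?case using Suc.IH[OF par_in[OF Suc.prems]] by (simp add: algebra_simps)
qed simp

lemma ancestor_of_base [simp]: "ancestor par k n b = b"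
  by (induction k arbitrary: n) (simp_all add: par_base)

lemma ancestor_base_mono:
  "ancestor par k n y = b \<Longrightarrow> k \<le> l \<Longrightarrow> ancestor par l n y = b"
  by (rotate_tac, induction rule: dec_induct) (simp_all only: ancestor_Suc par_base)

text \<open>Recursion with \<open>k\<close> steps of fuel, falling back on \<open>g\<close> when
  they are used up, whether or not \<open>b\<close> has been reached; the value is meaningful only
  for large enough \<open>k\<close>.\<close>

primrec unroll :: "(int \<Rightarrow> 'c) \<Rightarrow> (int \<Rightarrow> 'a \<Rightarrow> 'c \<Rightarrow> 'c) \<Rightarrow> nat \<Rightarrow> int \<Rightarrow> 'a \<Rightarrow> 'c" where
  "unroll g \<phi> 0 n y = g n"
| "unroll g \<phi> (Suc k) n y = \<phi> n y (unroll g \<phi> k (n - 1) (par n y))"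

text \<open>The prescribed values \<open>g\<close> already satisfy the recursion along the line of
  \<open>b\<close>. Running on after the ancestors have reached \<open>b\<close> therefore changes
  nothing, and the value does not depend on the number of steps.\<close>

lemma recursion_along_ancestors:
  fixes g :: "int \<Rightarrow> 'c"
  assumes "\<And>n. \<phi> n b (g (n - 1)) = g n"
  obtains h where "\<And>n. h n b = g n"
    and "\<And>n y. y \<in> T n \<Longrightarrow> h n y = \<phi> n y (h (n - 1) (par n y))"
proof -
  define d where "d n y = (LEAST k. ancestor par k n y = b)" for n y
  let ?h = "\<lambda>n y. unroll g \<phi> (d n y) n y"
  have *: "ancestor par k n y = b \<Longrightarrow> unroll g \<phi> (Suc k) n y = unroll g \<phi> k n y" for k n y
  proof (induction k arbitrary: n y)
    case (Suc k)
    then show ?case by (metis ancestor.simps(2) unroll.simps(2))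
  qed (simp add: par_base assms)
  have stable: "unroll g \<phi> l n y = unroll g \<phi> k n y" if "ancestor par k n y = b" "k \<le> l" for k l n y
    using that(2)
  proof (induction rule: dec_induct)
    case (step l)
    then show ?case using *[OF ancestor_base_mono[OF that(1) step(1)]] by simp
  qed simp
  have d: "ancestor par (d n y) n y = b" if "y \<in> T n" for n y
    unfolding d_def using ancestor_base[OF that] by (rule LeastI_ex)
  have "?h n b = g n" for n
    using stable[of 0 n b "d n b"] by simp
  moreover have "?h n y = \<phi> n y (?h (n - 1) (par n y))" if "y \<in> T n" for n y
  proof -
    \<comment> \<open>The depths chosen for \<open>y\<close> and for its parent need not differ by
      one; a common bound lets a single unrolling step link the two.\<close>
    let ?k = "max (d n y) (d (n - 1) (par n y))"
    have "?h n y = unroll g \<phi> (Suc ?k) n y"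
      using stable[OF d[OF that], of "Suc ?k"] by simp
    also have "\<dots> = \<phi> n y (?h (n - 1) (par n y))"
      using stable[OF d[OF par_in[OF that]], of ?k] by simp
    finally show ?thesis by simp
  qed
  ultimately show ?thesis by (rule that[of ?h])
qed

end

text \<open>Intervals of lengths \<open>w\<close> laid end to end in the order of \<open>rk\<close>
  leave no gap: an element of largest rank appends its interval on the right.\<close>

lemma ex_partial_sum_interval:
  fixes w :: "'a \<Rightarrow> real" and rk :: "'a \<Rightarrow> nat"
  assumes "finite C" "inj_on rk C" "c \<le> u" "u < c + sum w C"
  shows "\<exists>y\<in>C. c + sum w {x \<in> C. rk x < rk y} \<le> u \<and> u < c + sum w {x \<in> C. rk x < rk y} + w y"
  using assms
proof (induction C rule: finite_ranking_induct[where f = rk])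
  case (insert x S)
  show ?case
  proof (cases "x \<in> S")
    case True
    then show ?thesis using insert.IH insert.prems by (simp add: insert_absorb)
  next
    case False
    have lt: "rk y < rk x" if "y \<in> S" for y
    proof -
      have "rk y \<noteq> rk x" using insert.prems(1) that False by (auto simp: inj_on_def)
      then show ?thesis using insert.hyps(2)[OF that] by simp
    qed
    show ?thesis
    proof (cases "u < c + sum w S")
      case True
      then obtain y where y: "y \<in> S" "c + sum w {x \<in> S. rk x < rk y} \<le> u"
        "u < c + sum w {x \<in> S. rk x < rk y} + w y"
        using insert.IH[OF inj_on_subset[OF insert.prems(1) subset_insertI] insert.prems(2)] by blast
      moreover have "{z \<in> insert x S. rk z < rk y} = {x \<in> S. rk x < rk y}"
        using lt[OF y(1)] by auto
      ultimately show ?thesis by (intro bexI[of _ y]) simp_all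
    next
      assume *: "\<not> u < c + sum w S"
      have "{z \<in> insert x S. rk z < rk x} = S" using lt by auto
      then show ?thesis using * insert.prems False insert.hyps(1) by auto
    qed
  qed
qed auto

section \<open>Nested intervals attached to the nodes\<close>

locale weighted_tree = level_tree +
  fixes W :: "int \<Rightarrow> 'a \<Rightarrow> real"
  assumes weight_pos: "y \<in> T n \<Longrightarrow> 0 < W n y"
    and weight_children: "z \<in> T (n - 1) \<Longrightarrow> sum (W n) {y \<in> T n. par n y = z} = W (n - 1) z"
begin

lemma weight_nonneg: "y \<in> T n \<Longrightarrow> 0 \<le> W n y"
  using weight_pos by (rule less_imp_le)

text \<open>The base node precedes its siblings, so that its intervals can all start at the same point.\<close>

definition rank :: "int \<Rightarrow> 'a \<Rightarrow> nat" where
  "rank n y = (if y = b then 0 else Suc (to_nat_on (T n) y))"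

definition older :: "int \<Rightarrow> 'a \<Rightarrow> 'a set" where
  "older n y = {x \<in> T n. par n x = par n y \<and> rank n x < rank n y}"

lemma inj_rank: "inj_on (rank n) (T n)"
  using inj_on_to_nat_on[OF countable_level] by (auto simp: rank_def inj_on_def)

lemma older_base [simp]: "older n b = {}"
  by (auto simp: older_def rank_def)

lemma finite_older: "y \<in> T n \<Longrightarrow> finite (older n y)"
  unfolding older_def by (rule finite_subset[OF _ finite_children[OF par_in]]) auto

text \<open>The value 0 along the base line is consistent because \<open>b\<close> has no older
  siblings.\<close>

lemma ex_interval_start:
  "\<exists>a. \<forall>n. \<forall>y\<in>T n. a n y = sum (W n) (older n y) + a (n - 1) (par n y)"
proof -
  obtain a where "\<And>n. a n b = (0::real)"
    "\<And>n y. y \<in> T n \<Longrightarrow> a n y = sum (W n) (older n y) + a (n - 1) (par n y)"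
    by (rule recursion_along_ancestors[of "\<lambda>n y v. sum (W n) (older n y) + v" "\<lambda>_. 0"]) auto
  then show ?thesis by blast
qed

definition start :: "int \<Rightarrow> 'a \<Rightarrow> real" where
  "start = (SOME a. \<forall>n. \<forall>y\<in>T n. a n y = sum (W n) (older n y) + a (n - 1) (par n y))"

lemma start_eq: "y \<in> T n \<Longrightarrow> start n y = sum (W n) (older n y) + start (n - 1) (par n y)"
  using someI_ex[OF ex_interval_start] unfolding start_def by blast

definition slot :: "int \<Rightarrow> 'a \<Rightarrow> real set" where
  "slot n y = {start n y ..< start n y + W n y}"

lemma slot_subset_parent:
  assumes "y \<in> T n"
  shows "slot n y \<subseteq> slot (n - 1) (par n y)"
proof -
  let ?C = "{x \<in> T n. par n x = par n y}"
  have fin: "finite ?C" by (rule finite_children[OF par_in[OF assms]])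
  have "sum (W n) (older n y) + W n y = sum (W n) (insert y (older n y))"
    using finite_older[OF assms] by (subst sum.insert) (auto simp: older_def)
  also have "\<dots> \<le> sum (W n) ?C"
    by (rule sum_mono2[OF fin]) (auto simp: older_def assms intro!: weight_nonneg)
  finally have "sum (W n) (older n y) + W n y \<le> W (n - 1) (par n y)"
    using weight_children[OF par_in[OF assms]] by simp
  moreover have "0 \<le> sum (W n) (older n y)"
    by (rule sum_nonneg) (auto simp: older_def intro!: weight_nonneg)
  ultimately show ?thesis using start_eq[OF assms] by (auto simp: slot_def)
qed

lemma slot_siblings_disjoint:
  assumes "y \<in> T n" "y' \<in> T n" "par n y = par n y'" "u \<in> slot n y" "u \<in> slot n y'"
  shows "y = y'"
proof -
  have False if *: "y \<in> T n" "y' \<in> T n" "par n y = par n y'" "u \<in> slot n y" "u \<in> slot n y'"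
    "rank n y < rank n y'" for y y'
  proof -
    have "sum (W n) (older n y) + W n y = sum (W n) (insert y (older n y))"
      using finite_older[OF *(1)] by (subst sum.insert) (auto simp: older_def)
    also have "\<dots> \<le> sum (W n) (older n y')"
      by (rule sum_mono2[OF finite_older[OF *(2)]])
        (use * in \<open>auto simp: older_def intro!: weight_nonneg\<close>)
    finally show False
      using * start_eq[OF *(1)] start_eq[OF *(2)] by (auto simp: slot_def)
  qed
  from this[of y y'] this[of y' y] assms have "rank n y = rank n y'"
    by (cases "rank n y" "rank n y'" rule: linorder_cases) auto
  then show ?thesis using inj_onD[OF inj_rank _ assms(1,2)] by simp
qed

text \<open>A common point also lies in the slots of the parents, so induction on the number of
  steps to a common ancestor reduces the claim to siblings.\<close>

lemma slot_disjoint: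
  assumes "y \<in> T n" "y' \<in> T n" "u \<in> slot n y" "u \<in> slot n y'"
  shows "y = y'"
proof -
  have *: "y \<in> T n \<Longrightarrow> y' \<in> T n \<Longrightarrow> u \<in> slot n y \<Longrightarrow> u \<in> slot n y' \<Longrightarrow>
    ancestor par k n y = ancestor par k n y' \<Longrightarrow> y = y'" for k n y y'
  proof (induction k arbitrary: n y y')
    case (Suc k)
    have "par n y = par n y'"
    proof (rule Suc.IH)
      show "par n y \<in> T (n - 1)" "par n y' \<in> T (n - 1)"
        using Suc.prems(1,2) by (simp_all add: par_in)
      show "u \<in> slot (n - 1) (par n y)" "u \<in> slot (n - 1) (par n y')"
        using slot_subset_parent Suc.prems(1-4) by blast+
      show "ancestor par k (n - 1) (par n y) = ancestor par k (n - 1) (par n y')"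
        using Suc.prems(5) by simp
    qed
    then show ?case using slot_siblings_disjoint[OF Suc.prems(1,2)] Suc.prems(3,4) by simp
  qed simp
  obtain k k' where "ancestor par k n y = b" "ancestor par k' n y' = b"
    using ancestor_base[OF assms(1)] ancestor_base[OF assms(2)] by blast
  then have "ancestor par (max k k') n y = ancestor par (max k k') n y'"
    using ancestor_base_mono[of k n y "max k k'"] ancestor_base_mono[of k' n y' "max k k'"] by simp
  then show ?thesis using *[OF assms] by simp
qed

lemma slot_children:
  assumes "z \<in> T (n - 1)" "u \<in> slot (n - 1) z"
  shows "\<exists>y\<in>T n. par n y = z \<and> u \<in> slot n y"
proof -
  let ?C = "{y \<in> T n. par n y = z}"
  obtain y where y: "y \<in> ?C" and
    "start (n - 1) z + sum (W n) {x \<in> ?C. rank n x < rank n y} \<le> u"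
    "u < start (n - 1) z + sum (W n) {x \<in> ?C. rank n x < rank n y} + W n y"
    using ex_partial_sum_interval[of ?C "rank n" "start (n - 1) z" u "W n"]
      finite_children[OF assms(1)] inj_on_subset[OF inj_rank, of ?C n] assms(2)
      weight_children[OF assms(1)] by (auto simp: slot_def)
  moreover have "{x \<in> ?C. rank n x < rank n y} = older n y"
    using y by (auto simp: older_def)
  ultimately show ?thesis
    using start_eq[of y n] by (intro bexI[of _ y]) (auto simp: slot_def)
qed

lemma slot_base_mono: "slot n b \<subseteq> slot (n - int k) b"
proof (induction k)
  case (Suc k)
  have "slot (n - int k) b \<subseteq> slot (n - int k - 1) b"
    using slot_subset_parent[OF base_in, of "n - int k"] by (simp add: par_base)
  with Suc show ?case by (auto simp: algebra_simps)
qed simp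

text \<open>The base slots share their left end and grow towards coarse levels, so this is a
  half-open interval or a half-line. Its points stand for the branches of the tree.\<close>

definition ends :: "real set" where
  "ends = (\<Union>n. slot n b)"

lemma slot_subset_ends: "y \<in> T n \<Longrightarrow> slot n y \<subseteq> ends"
proof -
  have "slot n y \<subseteq> slot (n - int k) (ancestor par k n y)" if "y \<in> T n" for k n y
    using that
  proof (induction k arbitrary: n y)
    case (Suc k)
    have "slot n y \<subseteq> slot (n - 1) (par n y)"
      using slot_subset_parent Suc.prems by blast
    also have "\<dots> \<subseteq> slot (n - 1 - int k) (ancestor par k (n - 1) (par n y))"
      using Suc.IH[OF par_in[OF Suc.prems]] .
    finally show ?case by (simp add: algebra_simps)
  qed simp
  then show "y \<in> T n \<Longrightarrow> slot n y \<subseteq> ends"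
    using ancestor_base[of y n] unfolding ends_def by (metis UN_I UNIV_I subset_iff)
qed

text \<open>For existence, pass to a level at least as coarse as \<open>n\<close> at which the base
  slot contains \<open>u\<close>, then descend to \<open>n\<close>, using that the slots of the
  children cover the slot of their parent.\<close>

lemma ex1_slot:
  assumes "u \<in> ends"
  shows "\<exists>!y. y \<in> T n \<and> u \<in> slot n y"
proof -
  obtain m where "u \<in> slot m b" using assms by (auto simp: ends_def)
  then have "u \<in> slot (min m n) b"
    using slot_base_mono[of m "nat (m - min m n)"] by auto
  moreover have "\<exists>y\<in>T (l + int k). u \<in> slot (l + int k) y" if "u \<in> slot l b" for k l
  proof (induction k)
    case 0
    then show ?case using that base_in[of l] by auto
  next
    case (Suc k)
    then obtain z where "z \<in> T (l + int k)" "u \<in> slot (l + int k) z" by blast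
    then show ?case
      using slot_children[of z "l + int (Suc k)" u] by (auto simp: algebra_simps)
  qed
  ultimately have "\<exists>y\<in>T (min m n + int (nat (n - min m n))).
    u \<in> slot (min m n + int (nat (n - min m n))) y" by blast
  then have "\<exists>y\<in>T n. u \<in> slot n y" by simp
  then show ?thesis using slot_disjoint by blast
qed

definition node :: "int \<Rightarrow> real \<Rightarrow> 'a" where
  "node n u = (THE y. y \<in> T n \<and> u \<in> slot n y)"

lemma node_in: "u \<in> ends \<Longrightarrow> node n u \<in> T n"
  and in_slot_node: "u \<in> ends \<Longrightarrow> u \<in> slot n (node n u)"
  using theI'[OF ex1_slot] unfolding node_def by blast+

lemma node_eq: "y \<in> T n \<Longrightarrow> u \<in> slot n y \<Longrightarrow> node n u = y"
  using slot_disjoint node_in in_slot_node slot_subset_ends by (meson subsetD)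

lemma par_node: "u \<in> ends \<Longrightarrow> par n (node n u) = node (n - 1) u"
  by (rule node_eq[OF par_in[OF node_in] subsetD[OF slot_subset_parent[OF node_in] in_slot_node], symmetric])

lemma node_vimage: "y \<in> T n \<Longrightarrow> {u \<in> ends. node n u = y} = slot n y"
  using node_eq[of y n] in_slot_node[of _ n] slot_subset_ends[of y n] by auto

lemma emeasure_slot: "y \<in> T n \<Longrightarrow> emeasure lborel (slot n y) = ennreal (W n y)"
  using weight_pos[of y n] by (simp add: slot_def)

lemma ends_sets: "ends \<in> sets lborel"
  unfolding ends_def slot_def by (rule sets.countable_UN) auto

text \<open>The level is countable, so preimages of single nodes suffice, and these are
  slots.\<close>

lemma node_measurable:
  "node n \<in> measurable (restrict_space lborel ends) (count_space UNIV)"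
proof -
  have "node n \<in> measurable (restrict_space lborel ends) (count_space (T n))"
  proof (subst measurable_count_space_eq_countable[OF countable_level], intro conjI ballI)
    show "node n \<in> space (restrict_space lborel ends) \<rightarrow> T n"
      using node_in by (auto simp: space_restrict_space)
    fix y assume "y \<in> T n"
    then have "node n -` {y} \<inter> space (restrict_space lborel ends) = slot n y"
      using node_vimage by (auto simp: space_restrict_space)
    moreover have "slot n y \<in> sets (restrict_space lborel ends)"
      using slot_subset_ends[OF \<open>y \<in> T n\<close>] ends_sets
      by (subst sets_restrict_space_iff) (auto simp: slot_def)
    ultimately show "node n -` {y} \<inter> space (restrict_space lborel ends)
      \<in> sets (restrict_space lborel ends)" by simp
  qed
  from measurable_comp[OF this, of id "count_space UNIV"] show ?thesis by simp
qed

end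

section \<open>The measure of a hierarchy of nets\<close>

text \<open>Every set has a Borel hull of the same outer measure. Applied to hulls, the additivity
  of \<open>M\<close> gives both subadditivity and the Caratheodory condition for arbitrary
  sets.\<close>

lemma measure_on_space_outer_measure_of:
  fixes M :: "'a::metric_space measure"
  assumes M: "sets M = sets borel" and "emeasure M (space M) \<noteq> 0"
    and fin: "\<And>A. bounded A \<Longrightarrow> outer_measure_of M A < \<infinity>"
  shows "measure_on_space (outer_measure_of M)"
proof -
  let ?\<mu> = "outer_measure_of M"
  have sp: "space M = UNIV" using sets_eq_imp_space_eq[OF M] by simp
  have att: "\<exists>E\<in>sets M. A \<subseteq> E \<and> ?\<mu> A = emeasure M E" for A
    by (rule outer_measure_of_attain) (simp add: sp)
  have "countably_subadditive UNIV ?\<mu>"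
    unfolding countably_subadditive_def
  proof (intro allI impI)
    fix A :: "nat \<Rightarrow> 'a set"
    obtain E where E: "\<And>i. E i \<in> sets M" "\<And>i. A i \<subseteq> E i" "\<And>i. ?\<mu> (A i) = emeasure M (E i)"
    proof -
      have "\<forall>i. \<exists>E. E \<in> sets M \<and> A i \<subseteq> E \<and> ?\<mu> (A i) = emeasure M E"
        using att by blast
      then show thesis using that unfolding choice_iff by blast
    qed
    have "?\<mu> (\<Union>i. A i) \<le> ?\<mu> (\<Union>i. E i)"
      by (rule outer_measure_of_mono) (use E(2) in blast)
    also have "\<dots> = emeasure M (\<Union>i. E i)" using E(1) by auto
    also have "\<dots> \<le> (\<Sum>i. emeasure M (E i))"
      by (rule emeasure_subadditive_countably) (use E(1) in auto)
    finally show "?\<mu> (\<Union>i. A i) \<le> (\<Sum>i. ?\<mu> (A i))" using E(3) by simp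
  qed
  then have "outer_measure_space UNIV ?\<mu>"
    by (auto simp: outer_measure_space_def positive_def increasing_def intro: outer_measure_of_mono)
  moreover have "sets borel \<subseteq> lambda_system UNIV UNIV ?\<mu>"
  proof
    fix B :: "'a set" assume "B \<in> sets borel"
    then have B: "B \<in> sets M" using M by simp
    have "?\<mu> (B \<inter> A) + ?\<mu> ((UNIV - B) \<inter> A) = ?\<mu> A" for A
    proof (rule antisym)
      obtain E where E: "E \<in> sets M" "A \<subseteq> E" "?\<mu> A = emeasure M E" using att by blast
      have "?\<mu> (B \<inter> A) + ?\<mu> ((UNIV - B) \<inter> A) \<le> ?\<mu> (E \<inter> B) + ?\<mu> (E - B)"
        by (intro add_mono outer_measure_of_mono) (use E(2) in auto)
      also have "\<dots> = emeasure M (E \<inter> B) + emeasure M (E - B)" using E(1) B by auto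
      also have "\<dots> = emeasure M E"
        using E(1) B by (subst plus_emeasure) (auto intro!: arg_cong[where f = "emeasure M"])
      finally show "?\<mu> (B \<inter> A) + ?\<mu> ((UNIV - B) \<inter> A) \<le> ?\<mu> A" using E(3) by simp
      obtain F where F: "F \<in> sets M" "B \<inter> A \<subseteq> F" "?\<mu> (B \<inter> A) = emeasure M F" using att by blast
      obtain G where G: "G \<in> sets M" "(UNIV - B) \<inter> A \<subseteq> G" "?\<mu> ((UNIV - B) \<inter> A) = emeasure M G"
        using att by blast
      have "?\<mu> A \<le> ?\<mu> (F \<union> G)" by (rule outer_measure_of_mono) (use F(2) G(2) in auto)
      also have "\<dots> = emeasure M (F \<union> G)" using F(1) G(1) by auto
      also have "\<dots> \<le> emeasure M F + emeasure M G"
        by (rule emeasure_subadditive) (use F(1) G(1) in auto)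
      finally show "?\<mu> A \<le> ?\<mu> (B \<inter> A) + ?\<mu> ((UNIV - B) \<inter> A)" using F(3) G(3) by simp
    qed
    then show "B \<in> lambda_system UNIV UNIV ?\<mu>" by (simp add: lambda_system_def)
  qed
  moreover have "\<exists>B\<in>sets borel. A \<subseteq> B \<and> ?\<mu> B = ?\<mu> A" for A
    using att[of A] M by (metis outer_measure_of_eq)
  moreover have "?\<mu> UNIV \<noteq> 0"
    using assms(2) sp by (metis outer_measure_of_eq sets.top)
  ultimately show ?thesis using fin unfolding measure_on_space_def by blast
qed

text \<open>Supplies the weights on the base line, where each level prescribes only a ratio. The
  normalisation is \<open>g 0 = 1\<close>, with reciprocals of products at negative levels.\<close>

lemma ex_two_sided_product:
  fixes r :: "int \<Rightarrow> real"
  assumes "\<And>n. 0 < r n"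
  obtains g where "\<And>n. 0 < g n" "\<And>n. g n = r n * g (n - 1)"
proof -
  let ?g = "\<lambda>n::int. if 0 \<le> n then prod r {1..n} else 1 / prod r {n + 1..0}"
  have pos: "0 < ?g n" for n
    using assms by (auto intro!: prod_pos)
  moreover have "?g n = r n * ?g (n - 1)" for n
  proof (cases "1 \<le> n")
    case True
    then have "{1..n} = insert n {1..n - 1}" by auto
    then show ?thesis using True by simp
  next
    case False
    then have "{n..0} = insert n {n + 1..0}" by auto
    then show ?thesis using False assms[of n] by auto
  qed
  ultimately show ?thesis by (rule that)
qed

text \<open>\<open>card_local\<close> is to come from the doubling property; its radius 12 has to
  contain the children of a node and the nodes that contribute to a doubled ball.
  \<open>card_core\<close> is to come from the lower dimension and inherits the restriction to
  scales below the diameter.\<close>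

locale net_hierarchy =
  fixes \<delta> s p :: real and b :: "'a::metric_space" and T :: "int \<Rightarrow> 'a set"
  assumes delta_pos: "0 < \<delta>" and delta_le: "\<delta> \<le> 1 / 100"
    and s_nonneg: "0 \<le> s"
    and p_pos: "0 < p" and p_le: "p \<le> \<delta> powr s"
    and b_in: "b \<in> T n"
    and separated: "x \<in> T n \<Longrightarrow> y \<in> T n \<Longrightarrow> x \<noteq> y \<Longrightarrow> \<delta> powi n \<le> dist x y"
    and covering: "\<exists>y\<in>T n. dist x y < \<delta> powi n"
    and finite_local: "finite {y \<in> T n. dist x y \<le> R}"
    and card_local: "real (card {y \<in> T n. dist x y \<le> 12 * \<delta> powi (n - 1)}) * p \<le> 1"
    and card_core: "z \<in> T (n - 1) \<Longrightarrow> ereal (\<delta> powi (n - 1) / 8) < ediameter (UNIV :: 'a set) \<Longrightarrow>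
      \<delta> powr (- s) \<le> real (card {y \<in> T n. dist y z < \<delta> powi (n - 1) / 4})"
    and complete_space: "complete (UNIV :: 'a set)"
begin

section \<open>Scales, levels and parents\<close>

lemma scale_pos: "0 < \<delta> powi n"
  using delta_pos by simp

lemma scale_nonneg: "0 \<le> \<delta> powi n"
  by (rule less_imp_le[OF scale_pos])

lemma scale_step: "\<delta> powi n = \<delta> * \<delta> powi (n - 1)"
  using power_int_minus_mult[of \<delta> n] delta_pos by (simp add: mult.commute)

lemma scale_small: "100 * \<delta> powi n \<le> \<delta> powi (n - 1)"
proof -
  have "\<delta> * \<delta> powi (n - 1) \<le> 1 / 100 * \<delta> powi (n - 1)"
    using delta_le scale_nonneg by (intro mult_right_mono) auto
  then show ?thesis using scale_step[of n] by simp
qed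

lemma scale_antimono: "m \<le> n \<Longrightarrow> \<delta> powi n \<le> \<delta> powi m"
  using delta_pos delta_le by (intro power_int_decreasing) auto

lemma scale_unbounded: "\<exists>k. D < \<delta> powi (n - int k)"
proof -
  obtain k where k: "D / \<delta> powi n < (1 / \<delta>) ^ k"
    using real_arch_pow[of "1 / \<delta>"] delta_pos delta_le by auto
  have "\<delta> powi (n - int k) = \<delta> powi n * (1 / \<delta>) ^ k"
    using delta_pos by (simp add: power_int_diff power_divide)
  moreover have "D < \<delta> powi n * (1 / \<delta>) ^ k"
    using k scale_pos[of n] by (simp add: pos_divide_less_eq mult.commute)
  ultimately show ?thesis by metis
qed

lemma scale_tendsto: "(\<lambda>i. \<delta> powi (int i)) \<longlonglongrightarrow> 0"
  using delta_pos delta_le by (simp add: LIMSEQ_realpow_zero)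

text \<open>The factor 5 is 1 + 2 + 2 in units of \<open>\<delta> powi n\<close>: the distance from
  a centre to a net point, from there to an ancestor, and from the ancestor to the limit points
  below it.\<close>

lemma ex_level:
  assumes "0 < r"
  shows "\<exists>n. 5 * \<delta> powi n \<le> r \<and> r < 5 * \<delta> powi (n - 1)"
proof -
  let ?l = "log \<delta> (r / 5)"
  let ?n = "\<lceil>?l\<rceil>"
  have eq: "\<delta> powr ?l = r / 5"
    using assms delta_pos delta_le by (intro powr_log_cancel) auto
  have "\<delta> powr ?n \<le> \<delta> powr ?l"
    using delta_pos delta_le by (intro powr_mono') auto
  moreover have "\<delta> powr ?l < \<delta> powr real_of_int (?n - 1)"
    using delta_pos delta_le by (intro powr_less_mono') linarith+
  ultimately show ?thesis
    using eq powr_real_of_int'[of \<delta> ?n] powr_real_of_int'[of \<delta> "?n - 1"] delta_pos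
    by (intro exI[of _ ?n]) auto
qed

text \<open>By separation at most one node is within half the scale, so the first choice is forced;
  in particular \<open>b\<close> becomes its own parent.\<close>

definition par :: "int \<Rightarrow> 'a \<Rightarrow> 'a" where
  "par n y =
    (if \<exists>z\<in>T (n - 1). dist y z < \<delta> powi (n - 1) / 2
     then SOME z. z \<in> T (n - 1) \<and> dist y z < \<delta> powi (n - 1) / 2
     else SOME z. z \<in> T (n - 1) \<and> dist y z < \<delta> powi (n - 1))"

lemma par_in_T: "par n y \<in> T (n - 1)"
  and par_dist: "dist y (par n y) < \<delta> powi (n - 1)"
proof -
  have "par n y \<in> T (n - 1) \<and> dist y (par n y) < \<delta> powi (n - 1)"
  proof (cases "\<exists>z\<in>T (n - 1). dist y z < \<delta> powi (n - 1) / 2")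
    case True
    then have "\<exists>z. z \<in> T (n - 1) \<and> dist y z < \<delta> powi (n - 1) / 2" by blast
    from someI_ex[OF this] show ?thesis
      using True scale_pos[of "n - 1"] unfolding par_def if_P[OF True] by linarith
  next
    case False
    have "\<exists>z. z \<in> T (n - 1) \<and> dist y z < \<delta> powi (n - 1)" using covering by blast
    from someI_ex[OF this] show ?thesis unfolding par_def if_not_P[OF False] .
  qed
  then show "par n y \<in> T (n - 1)" "dist y (par n y) < \<delta> powi (n - 1)" by auto
qed

lemma par_unique:
  assumes "z \<in> T (n - 1)" "dist y z < \<delta> powi (n - 1) / 2"
  shows "par n y = z"
proof (rule ccontr)
  assume ne: "par n y \<noteq> z"
  have "\<exists>z. z \<in> T (n - 1) \<and> dist y z < \<delta> powi (n - 1) / 2" using assms by blast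
  from someI_ex[OF this] have "dist y (par n y) < \<delta> powi (n - 1) / 2"
    using assms by (auto simp: par_def)
  then have "dist (par n y) z < \<delta> powi (n - 1)"
    using assms(2) dist_triangle3[of "par n y" z y] by linarith
  then show False using separated[OF par_in_T assms(1) ne] by simp
qed

text \<open>The steps form a geometric series of ratio at most 1/100, bounded by twice its coarsest
  term.\<close>

lemma ancestor_dist: "dist y (ancestor par k n y) \<le> 2 * \<delta> powi (n - int k)"
proof (induction k)
  case (Suc k)
  let ?a = "ancestor par k n y"
  have "dist y (ancestor par (Suc k) n y) \<le> dist y ?a + dist ?a (par (n - int k) ?a)"
    unfolding ancestor_Suc by (rule dist_triangle)
  also have "\<dots> \<le> 2 * \<delta> powi (n - int k) + \<delta> powi (n - int k - 1)"
    using Suc par_dist[of ?a "n - int k"] by linarith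
  also have "\<dots> \<le> 2 * \<delta> powi (n - int k - 1)"
    using scale_small[of "n - int k"] scale_pos[of "n - int k"] by linarith
  finally show ?case by (simp add: algebra_simps)
qed (simp add: scale_nonneg)

lemma ex_ancestor_base: "\<exists>k. ancestor par k n y = b"
proof -
  \<comment> \<open>The factor 4 leaves room for the drift of the ancestor: 1/4 + 2/100 < 1/2, so
    \<open>par_unique\<close> forces the next parent to be \<open>b\<close>.\<close>
  obtain k where k: "4 * dist y b < \<delta> powi (n - 1 - int k)"
    using scale_unbounded by blast
  let ?a = "ancestor par k n y"
  have "dist ?a b \<le> dist y ?a + dist y b" by (rule dist_triangle3)
  also have "\<dots> < \<delta> powi (n - int k - 1) / 2"
  proof -
    have "n - 1 - int k = n - int k - 1" by simp
    from k[unfolded this] show ?thesis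
      using ancestor_dist[of y k n] scale_small[of "n - int k"] scale_pos[of "n - int k"]
      by linarith
  qed
  finally have "par (n - int k) ?a = b" by (intro par_unique b_in)
  then show ?thesis using ancestor_Suc[of par k n y] by blast
qed

sublocale level_tree T par b
proof
  show "b \<in> T n" for n by (rule b_in)
  show "par n b = b" for n by (rule par_unique[OF b_in]) (simp add: scale_pos)
  show "par n y \<in> T (n - 1)" for n y by (rule par_in_T)
  show "\<exists>k. ancestor par k n y = b" for n y by (rule ex_ancestor_base)
  show "finite {y \<in> T n. par n y = z}" for n z
    by (rule finite_subset[OF _ finite_local[of n z "\<delta> powi (n - 1)"]])
      (use par_dist[of _ n] in \<open>auto simp: dist_commute less_imp_le\<close>)
  have "T n = (\<Union>k::nat. {y \<in> T n. dist b y \<le> real k})" for n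
    using real_arch_simple by auto
  moreover have "countable (\<Union>k::nat. {y \<in> T n. dist b y \<le> real k})" for n
    by (rule countable_UN[OF countableI_type countable_finite[OF finite_local]])
  ultimately show "countable (T n)" for n by simp
qed

section \<open>Distribution of mass among the children\<close>

definition children :: "int \<Rightarrow> 'a \<Rightarrow> 'a set" where
  "children n z = {y \<in> T n. par n y = z}"

definition core :: "int \<Rightarrow> 'a \<Rightarrow> 'a set" where
  "core n z = {y \<in> T n. dist y z < \<delta> powi (n - 1) / 4}"

definition share :: "int \<Rightarrow> 'a \<Rightarrow> real" where
  "share n y = (let z = par n y in
    if y \<in> core n z then (1 - p * real (card (children n z - core n z))) / real (card (core n z))
    else p)"

lemma core_subset:
  assumes z: "z \<in> T (n - 1)"
  shows "core n z \<subseteq> children n z"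
proof -
  have "par n y = z" if "dist y z < \<delta> powi (n - 1) / 4" for y
    using par_unique[OF z, of y] that scale_pos[of "n - 1"] by linarith
  then show ?thesis by (auto simp: core_def children_def)
qed

lemma finite_children_set: "z \<in> T (n - 1) \<Longrightarrow> finite (children n z)"
  unfolding children_def by (rule finite_children)

lemma finite_core: "z \<in> T (n - 1) \<Longrightarrow> finite (core n z)"
  using finite_subset[OF core_subset finite_children_set] .

lemma card_core_pos: "z \<in> T (n - 1) \<Longrightarrow> 1 \<le> card (core n z)"
proof -
  assume z: "z \<in> T (n - 1)"
  obtain y where "y \<in> T n" "dist z y < \<delta> powi n" using covering by blast
  then have "y \<in> core n z"
    using scale_small[of n] scale_pos[of n] by (simp add: core_def dist_commute)
  then show "1 \<le> card (core n z)"
    using finite_core[OF z] by (metis Suc_leI card_gt_0_iff empty_iff One_nat_def)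
qed

lemma p_card_children: "z \<in> T (n - 1) \<Longrightarrow> p * real (card (children n z)) \<le> 1"
proof -
  assume z: "z \<in> T (n - 1)"
  have "children n z \<subseteq> {y \<in> T n. dist z y \<le> 12 * \<delta> powi (n - 1)}"
  proof
    fix y assume "y \<in> children n z"
    then show "y \<in> {y \<in> T n. dist z y \<le> 12 * \<delta> powi (n - 1)}"
      using par_dist[of y n] scale_pos[of "n - 1"] by (auto simp: children_def dist_commute)
  qed
  then have "card (children n z) \<le> card {y \<in> T n. dist z y \<le> 12 * \<delta> powi (n - 1)}"
    by (rule card_mono[OF finite_local])
  then have "p * real (card (children n z)) \<le> p * real (card {y \<in> T n. dist z y \<le> 12 * \<delta> powi (n - 1)})"
    using p_pos by simp
  then show "p * real (card (children n z)) \<le> 1" using card_local[of n z] by (simp add: mult.commute)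
qed

lemma card_children:
  "z \<in> T (n - 1) \<Longrightarrow>
    real (card (children n z)) = real (card (children n z - core n z)) + real (card (core n z))"
  using card_Diff_subset[OF finite_core core_subset] card_mono[OF finite_children_set core_subset]
  by (simp add: of_nat_diff)

lemma share_outer: "y \<notin> core n (par n y) \<Longrightarrow> share n y = p"
  by (simp add: share_def Let_def)

lemma sum_share:
  assumes z: "z \<in> T (n - 1)"
  shows "sum (share n) (children n z) = 1"
proof -
  have "sum (share n) (children n z) = sum (share n) (children n z - core n z) + sum (share n) (core n z)"
    by (rule sum.subset_diff[OF core_subset[OF z] finite_children_set[OF z]])
  also have "sum (share n) (children n z - core n z) = (\<Sum>y\<in>children n z - core n z. p)"
    by (rule sum.cong) (auto simp: children_def share_def Let_def)
  also have "sum (share n) (core n z)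
    = (\<Sum>y\<in>core n z. (1 - p * real (card (children n z - core n z))) / real (card (core n z)))"
    using core_subset[OF z] by (intro sum.cong refl) (auto simp: share_def Let_def children_def subset_iff)
  finally show ?thesis using card_core_pos[OF z] by simp
qed

text \<open>Since \<open>p\<close> times the number of all children is at most 1, at least
  \<open>p\<close> per core child is left after the outer children have received theirs.\<close>

lemma share_ge: "p \<le> share n y"
proof (cases "y \<in> core n (par n y)")
  case True
  let ?z = "par n y"
  have "p * real (card (children n ?z - core n ?z)) + p * real (card (core n ?z)) \<le> 1"
    using p_card_children[OF par_in_T, of n y] card_children[OF par_in_T, of n y]
    by (simp add: algebra_simps)
  then show ?thesis
    using True card_core_pos[OF par_in_T, of n y] by (simp add: share_def Let_def field_simps)
qed (simp add: share_outer)

lemma share_pos: "0 < share n y"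
  using share_ge[of n y] p_pos by linarith

lemma share_le_max: "share n y \<le> max p (1 / real (card (core n (par n y))))"
proof (cases "y \<in> core n (par n y)")
  case True
  then have "share n y \<le> 1 / real (card (core n (par n y)))"
    using p_pos by (simp add: share_def Let_def divide_right_mono)
  then show ?thesis by linarith
qed (simp add: share_outer)

lemma delta_powr_le_1: "\<delta> powr s \<le> 1"
  using powr_mono'[of 0 s \<delta>] s_nonneg delta_pos delta_le by simp

lemma share_le_1: "share n y \<le> 1"
proof -
  have "1 / real (card (core n (par n y))) \<le> 1"
    using card_core_pos[OF par_in_T, of n y] by simp
  then show ?thesis using share_le_max[of n y] p_le delta_powr_le_1 by linarith
qed

lemma share_le:
  assumes "ereal (\<delta> powi (n - 1) / 8) < ediameter (UNIV :: 'a set)"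
  shows "share n y \<le> \<delta> powr s"
proof -
  have "\<delta> powr (- s) \<le> real (card (core n (par n y)))"
    unfolding core_def by (rule card_core[OF par_in_T assms])
  then have "1 / real (card (core n (par n y))) \<le> 1 / \<delta> powr (- s)"
    using delta_pos by (intro frac_le) simp_all
  also have "\<dots> = \<delta> powr s" by (simp add: powr_minus_divide)
  finally show ?thesis using share_le_max[of n y] p_le by linarith
qed

text \<open>The two-sided product with ratios \<open>share n b\<close> gives values on the base line
  that are consistent with the recursion.\<close>

lemma ex_weight:
  "\<exists>W. (\<forall>n. 0 < W n b) \<and> (\<forall>n. \<forall>y\<in>T n. W n y = share n y * W (n - 1) (par n y))"
proof -
  obtain g where g: "\<And>n. 0 < g n" "\<And>n. g n = share n b * g (n - 1)"
    by (rule ex_two_sided_product[of "\<lambda>n. share n b", OF share_pos]) (rule that)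
  obtain W where W: "\<And>n. W n b = g n"
    "\<And>n y. y \<in> T n \<Longrightarrow> W n y = share n y * W (n - 1) (par n y)"
    by (rule recursion_along_ancestors[of "\<lambda>n y w. share n y * w" g, OF g(2)[symmetric]]) (rule that)
  show ?thesis
  proof (intro exI[of _ W] conjI allI ballI)
    show "0 < W n b" for n using W(1)[of n] g(1)[of n] by simp
    show "W n y = share n y * W (n - 1) (par n y)" if "y \<in> T n" for n y by (rule W(2)[OF that])
  qed
qed

definition W :: "int \<Rightarrow> 'a \<Rightarrow> real" where
  "W = (SOME W. (\<forall>n. 0 < W n b) \<and> (\<forall>n. \<forall>y\<in>T n. W n y = share n y * W (n - 1) (par n y)))"

lemma W_base: "0 < W n b"
  and W_eq: "y \<in> T n \<Longrightarrow> W n y = share n y * W (n - 1) (par n y)"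
  using someI_ex[OF ex_weight] unfolding W_def by auto

lemma W_pos:
  assumes "y \<in> T n"
  shows "0 < W n y"
proof -
  have "y \<in> T n \<Longrightarrow> ancestor par k n y = b \<Longrightarrow> 0 < W n y" for k n y
  proof (induction k arbitrary: n y)
    case (Suc k)
    then have "0 < W (n - 1) (par n y)" using Suc.IH[OF par_in_T] by simp
    then show ?case using W_eq[OF Suc.prems(1)] share_pos[of n y] by simp
  qed (simp add: W_base)
  then show ?thesis using ex_ancestor_base assms by blast
qed

sublocale weighted_tree T par b W
proof
  show "y \<in> T n \<Longrightarrow> 0 < W n y" for n y by (rule W_pos)
  fix z n assume z: "z \<in> T (n - 1)"
  have "sum (W n) {y \<in> T n. par n y = z} = (\<Sum>y\<in>children n z. share n y * W (n - 1) z)"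
    unfolding children_def by (rule sum.cong) (auto simp: W_eq)
  also have "\<dots> = W (n - 1) z"
    using sum_share[OF z] by (simp flip: sum_distrib_right)
  finally show "sum (W n) {y \<in> T n. par n y = z} = W (n - 1) z" .
qed

text \<open>
  Distinct parents of two nearby nodes force both nodes to be outer children, which carry the same
  fraction \<open>p\<close>; hence the ratio of the weights changes only at the level where the lines of
  ancestors meet.
\<close>

lemma W_comparable:
  assumes "y \<in> T n" "y' \<in> T n" "dist y y' \<le> 18 * \<delta> powi n"
  shows "p * W n y \<le> W n y'"
proof -
  have p1: "p \<le> 1" using p_le delta_powr_le_1 by linarith
  have "y \<in> T n \<Longrightarrow> y' \<in> T n \<Longrightarrow> dist y y' \<le> 18 * \<delta> powi n \<Longrightarrow>
    ancestor par k n y = ancestor par k n y' \<Longrightarrow> p * W n y \<le> W n y'" for k n y y'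
  proof (induction k arbitrary: n y y')
    case 0
    then show ?case using mult_right_mono[OF p1 weight_nonneg[OF 0(2)]] by simp
  next
    case (Suc k)
    note y = Suc.prems(1) and y' = Suc.prems(2)
    show ?case
    proof (cases "par n y = par n y'")
      \<comment> \<open>The lines meet here. The two fractions may differ, but both lie between
        \<open>p\<close> and 1, and this costs the single factor \<open>p\<close>.\<close>
      case True
      let ?w = "W (n - 1) (par n y)"
      have w: "0 \<le> ?w" by (rule weight_nonneg[OF par_in_T])
      have "W n y \<le> ?w"
        using W_eq[OF y] mult_right_mono[OF share_le_1 w, of n y] by simp
      then have "p * W n y \<le> p * ?w" using p_pos by simp
      also have "\<dots> \<le> share n y' * ?w" by (rule mult_right_mono[OF share_ge w])
      finally show ?thesis using W_eq[OF y'] True by simp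
    next
      case False
      \<comment> \<open>As 18/100 < 1/4, a neighbour of a core node is within 1/4 + 1/4 of the
        centre and would have the same parent.\<close>
      have sc: "18 * \<delta> powi n < \<delta> powi (n - 1) / 4"
        using scale_small[of n] scale_pos[of n] by linarith
      have "y \<notin> core n (par n y)"
      proof
        assume "y \<in> core n (par n y)"
        then have "dist y' (par n y) < \<delta> powi (n - 1) / 2"
          using dist_triangle[of y' "par n y" y] Suc.prems(3) sc
          by (simp add: core_def dist_commute)
        then show False using par_unique[OF par_in_T] False by metis
      qed
      moreover have "y' \<notin> core n (par n y')"
      proof
        assume "y' \<in> core n (par n y')"
        then have "dist y (par n y') < \<delta> powi (n - 1) / 2"
          using dist_triangle[of y "par n y'" y'] Suc.prems(3) sc
          by (simp add: core_def)
        then show False using par_unique[OF par_in_T] False by metis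
      qed
      moreover have "p * W (n - 1) (par n y) \<le> W (n - 1) (par n y')"
      proof (rule Suc.IH[OF par_in_T par_in_T])
        \<comment> \<open>The parents are at most 1 + 1/4 + 1 of their own scales apart, well within
          18, so the hypothesis reproduces itself one level up.\<close>
        have "dist (par n y) (par n y') \<le> dist y (par n y) + dist y y' + dist y' (par n y')"
          using dist_triangle[of "par n y" "par n y'" y] dist_triangle[of y "par n y'" y']
          by (simp add: dist_commute)
        also have "\<dots> \<le> 18 * \<delta> powi (n - 1)"
          using par_dist[of y n] par_dist[of y' n] Suc.prems(3) sc scale_pos[of "n - 1"] by linarith
        finally show "dist (par n y) (par n y') \<le> 18 * \<delta> powi (n - 1)" .
        show "ancestor par k (n - 1) (par n y) = ancestor par k (n - 1) (par n y')"
          using Suc.prems(4) by simp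
      qed
      ultimately show ?thesis
        using W_eq[OF y] W_eq[OF y'] p_pos by (simp add: share_outer)
    qed
  qed
  moreover obtain k k' where "ancestor par k n y = b" "ancestor par k' n y' = b"
    using ex_ancestor_base by blast
  then have "ancestor par (max k k') n y = ancestor par (max k k') n y'"
    using ancestor_base_mono[of k n y "max k k'"] ancestor_base_mono[of k' n y' "max k k'"] by simp
  ultimately show ?thesis using assms by blast
qed

text \<open>\<open>share_le\<close> is applied once per level; the diameter condition at the
  coarsest level passes to all finer ones.\<close>

lemma W_decay:
  "y \<in> T n \<Longrightarrow> ereal (\<delta> powi (n - int k) / 8) < ediameter (UNIV :: 'a set) \<Longrightarrow>
    W n y \<le> (\<delta> powr s) ^ k * W (n - int k) (ancestor par k n y)"
proof (induction k arbitrary: n y)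
  case (Suc k)
  have "ereal (\<delta> powi (n - 1) / 8) \<le> ereal (\<delta> powi (n - int (Suc k)) / 8)"
    using scale_antimono[of "n - int (Suc k)" "n - 1"] by simp
  then have "share n y \<le> \<delta> powr s"
    using Suc.prems(2) by (intro share_le) (rule le_less_trans)
  then have "W n y \<le> \<delta> powr s * W (n - 1) (par n y)"
    using W_eq[OF Suc.prems(1)] mult_right_mono weight_nonneg[OF par_in_T] by metis
  also have "\<dots> \<le> \<delta> powr s * ((\<delta> powr s) ^ k * W (n - 1 - int k) (ancestor par k (n - 1) (par n y)))"
    using Suc.prems(2) by (intro mult_left_mono Suc.IH par_in_T) (simp_all add: diff_diff_eq)
  finally show ?case by (simp add: diff_diff_eq mult.assoc)
qed simp

section \<open>Limit points of branches and the image measure\<close>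

lemma ancestor_node: "u \<in> ends \<Longrightarrow> ancestor par k n (node n u) = node (n - int k) u"
  by (induction k arbitrary: n) (simp_all add: par_node algebra_simps)

lemma node_dist: "u \<in> ends \<Longrightarrow> n \<le> m \<Longrightarrow> dist (node m u) (node n u) \<le> 2 * \<delta> powi n"
  using ancestor_dist[of "node m u" "nat (m - n)" m] ancestor_node[of u "nat (m - n)" m] by simp

definition pt :: "real \<Rightarrow> 'a" where
  "pt u = lim (\<lambda>i. node (int i) u)"

lemma node_tendsto:
  assumes "u \<in> ends"
  shows "(\<lambda>i. node (int i) u) \<longlonglongrightarrow> pt u"
proof -
  have "Cauchy (\<lambda>i. node (int i) u)"
  proof (rule metric_CauchyI)
    fix e :: real assume "0 < e"
    then have "\<forall>\<^sub>F i in sequentially. \<delta> powi (int i) < e / 4"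
      using order_tendstoD(2)[OF scale_tendsto, of "e / 4"] by simp
    then obtain N where N: "\<delta> powi (int N) < e / 4"
      by (auto simp: eventually_sequentially)
    show "\<exists>M. \<forall>m\<ge>M. \<forall>n\<ge>M. dist (node (int m) u) (node (int n) u) < e"
    proof (intro exI allI impI)
      fix m n assume "N \<le> m" "N \<le> n"
      then have "dist (node (int m) u) (node (int N) u) \<le> 2 * \<delta> powi (int N)"
        "dist (node (int n) u) (node (int N) u) \<le> 2 * \<delta> powi (int N)"
        by (auto intro!: node_dist[OF assms] simp del: power_int_of_nat)
      then show "dist (node (int m) u) (node (int n) u) < e"
        using N dist_triangle2[of "node (int m) u" "node (int n) u" "node (int N) u"] by linarith
    qed
  qed
  then have "convergent (\<lambda>i. node (int i) u)"
    using complete_space by (auto simp: complete_def convergent_def)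
  then show ?thesis by (simp add: pt_def convergent_LIMSEQ_iff)
qed

lemma node_pt_dist:
  assumes "u \<in> ends"
  shows "dist (pt u) (node n u) \<le> 2 * \<delta> powi n"
proof (rule tendsto_upperbound)
  show "(\<lambda>i. dist (node (int i) u) (node n u)) \<longlonglongrightarrow> dist (pt u) (node n u)"
    by (intro tendsto_intros node_tendsto assms)
  show "\<forall>\<^sub>F i in sequentially. dist (node (int i) u) (node n u) \<le> 2 * \<delta> powi n"
    using eventually_ge_at_top[of "nat n"] by eventually_elim (auto intro: node_dist[OF assms])
qed simp

lemma pt_measurable: "pt \<in> borel_measurable (restrict_space lborel ends)"
proof (rule borel_measurable_LIMSEQ_metric)
  show "node (int i) \<in> borel_measurable (restrict_space lborel ends)" for i
    using measurable_comp[OF node_measurable, of id borel] by simp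
  show "(\<lambda>i. node (int i) u) \<longlonglongrightarrow> pt u" if "u \<in> space (restrict_space lborel ends)" for u
    using that by (intro node_tendsto) (simp add: space_restrict_space)
qed

definition M :: "'a measure" where
  "M = distr (restrict_space lborel ends) borel pt"

lemma sets_M [simp]: "sets M = sets borel"
  by (simp add: M_def)

lemma emeasure_M:
  assumes "A \<in> sets borel"
  shows "emeasure M A = emeasure lborel {u \<in> ends. pt u \<in> A}"
    and "{u \<in> ends. pt u \<in> A} \<in> sets lborel"
proof -
  have eq: "pt -` A \<inter> space (restrict_space lborel ends) = {u \<in> ends. pt u \<in> A}"
    by (auto simp: space_restrict_space)
  have "emeasure M A = emeasure (restrict_space lborel ends) {u \<in> ends. pt u \<in> A}"
    unfolding M_def using emeasure_distr[OF pt_measurable assms] eq by simp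
  then show "emeasure M A = emeasure lborel {u \<in> ends. pt u \<in> A}"
    using ends_sets by (subst (asm) emeasure_restrict_space) auto
  show "{u \<in> ends. pt u \<in> A} \<in> sets lborel"
    using measurable_sets[OF pt_measurable assms] eq ends_sets
    by (simp add: sets_restrict_space_iff)
qed

text \<open>The passage to the outer measure turns the Borel measure \<open>M\<close> into a Borel
  regular outer measure on all sets.\<close>

definition \<mu> :: "'a set \<Rightarrow> ennreal" where
  "\<mu> = outer_measure_of M"

section \<open>Estimates for the measure of balls\<close>

lemma mu_cball: "\<mu> (cball x r) = emeasure lborel {u \<in> ends. pt u \<in> cball x r}"
  unfolding \<mu>_def using emeasure_M[of "cball x r"] by simp

lemma mu_mono: "A \<subseteq> B \<Longrightarrow> \<mu> A \<le> \<mu> B"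
  unfolding \<mu>_def by (rule outer_measure_of_mono)

text \<open>All of \<open>slot n y\<close> is mapped to points within
  \<open>2 * \<delta> powi n\<close> of \<open>y\<close>; the same error enlarges the radius in the
  upper bound \<open>mu_cball_le\<close>.\<close>

lemma mu_cball_ge:
  assumes "y \<in> T n" "dist x y + 2 * \<delta> powi n \<le> r"
  shows "ennreal (W n y) \<le> \<mu> (cball x r)"
proof -
  have "slot n y \<subseteq> {u \<in> ends. pt u \<in> cball x r}"
  proof
    fix u assume u: "u \<in> slot n y"
    then have "u \<in> ends" using slot_subset_ends[OF assms(1)] by blast
    moreover have "node n u = y" using node_eq[OF assms(1) u] .
    ultimately show "u \<in> {u \<in> ends. pt u \<in> cball x r}"
      using node_pt_dist[of u n] assms(2) dist_triangle[of x "pt u" y]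
      by (simp add: dist_commute)
  qed
  then have "emeasure lborel (slot n y) \<le> \<mu> (cball x r)"
    unfolding mu_cball using emeasure_M(2)[of "cball x r"] by (intro emeasure_mono) auto
  then show ?thesis using emeasure_slot[OF assms(1)] by simp
qed

lemma mu_cball_le:
  "\<mu> (cball x r) \<le> ennreal (sum (W n) {y \<in> T n. dist x y \<le> r + 2 * \<delta> powi n})"
proof -
  let ?Y = "{y \<in> T n. dist x y \<le> r + 2 * \<delta> powi n}"
  have "{u \<in> ends. pt u \<in> cball x r} \<subseteq> (\<Union>y\<in>?Y. slot n y)"
  proof
    fix u assume u: "u \<in> {u \<in> ends. pt u \<in> cball x r}"
    then have "dist x (node n u) \<le> r + 2 * \<delta> powi n"
      using node_pt_dist[of u n] dist_triangle[of x "node n u" "pt u"] by simp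
    then show "u \<in> (\<Union>y\<in>?Y. slot n y)" using u node_in in_slot_node by blast
  qed
  then have "\<mu> (cball x r) \<le> emeasure lborel (\<Union>y\<in>?Y. slot n y)"
    unfolding mu_cball using finite_local
    by (intro emeasure_mono sets.finite_UN) (auto simp: slot_def)
  also have "\<dots> \<le> (\<Sum>y\<in>?Y. emeasure lborel (slot n y))"
    by (rule emeasure_subadditive_finite) (auto simp: slot_def finite_local)
  also have "\<dots> = (\<Sum>y\<in>?Y. ennreal (W n y))"
    by (rule sum.cong) (auto simp: emeasure_slot)
  also have "\<dots> = ennreal (sum (W n) ?Y)"
    by (rule sum_ennreal) (auto intro: weight_nonneg)
  finally show ?thesis .
qed

text \<open>The doubled ball is covered with nodes one level coarser. The three factors
  \<open>p\<close> account for the number of these nodes, for \<open>W_comparable\<close> between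
  them and the parent of \<open>y\<close>, and for the fraction that this parent passes on to
  \<open>y\<close>.\<close>

lemma mu_cball_bounds:
  assumes y: "y \<in> T n" "dist x y < \<delta> powi n" and r: "5 * \<delta> powi n \<le> r" "r < 5 * \<delta> powi (n - 1)"
  shows "ennreal (W n y) \<le> \<mu> (cball x r)"
    and "\<mu> (cball x (2 * r)) \<le> ennreal (W n y / p ^ 3)"
proof -
  show "ennreal (W n y) \<le> \<mu> (cball x r)"
    using y r(1) scale_pos[of n] by (intro mu_cball_ge) auto
  let ?Y = "{z \<in> T (n - 1). dist x z \<le> 2 * r + 2 * \<delta> powi (n - 1)}"
  have sub: "?Y \<subseteq> {z \<in> T (n - 1). dist x z \<le> 12 * \<delta> powi (n - 1)}"
    using r(2) by auto
  \<comment> \<open>At level \<open>n - 1\<close>, \<open>card_local\<close> counts up to 12 times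
    the scale of level \<open>n - 2\<close>, hence this second enlargement.\<close>
  also have "\<dots> \<subseteq> {z \<in> T (n - 1). dist x z \<le> 12 * \<delta> powi (n - 1 - 1)}"
    using scale_antimono[of "n - 1 - 1" "n - 1"] by auto
  finally have "card ?Y \<le> card {z \<in> T (n - 1). dist x z \<le> 12 * \<delta> powi (n - 1 - 1)}"
    by (rule card_mono[OF finite_local])
  then have "real (card ?Y) * p \<le> real (card {z \<in> T (n - 1). dist x z \<le> 12 * \<delta> powi (n - 1 - 1)}) * p"
    using p_pos by simp
  also have "\<dots> \<le> 1" by (rule card_local)
  finally have card: "real (card ?Y) \<le> 1 / p" using p_pos by (simp add: field_simps)
  have each: "W (n - 1) z \<le> W n y / p ^ 2" if "z \<in> ?Y" for z
  proof -
    \<comment> \<open>In units of the coarser scale the sum is at most 12 + 1/100 + 1, below the 18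
      of \<open>W_comparable\<close>.\<close>
    have "dist z (par n y) \<le> dist x z + dist x y + dist y (par n y)"
      using dist_triangle[of z "par n y" x] dist_triangle[of x "par n y" y] by (simp add: dist_commute)
    also have "\<dots> \<le> 18 * \<delta> powi (n - 1)"
      using that sub y(2) par_dist[of y n] scale_small[of n] scale_pos[of n] by auto
    finally have "p * W (n - 1) z \<le> W (n - 1) (par n y)"
      using that by (intro W_comparable par_in_T) auto
    moreover have "p * W (n - 1) (par n y) \<le> W n y"
      using W_eq[OF y(1)] mult_right_mono[OF share_ge weight_nonneg[OF par_in_T]] by metis
    ultimately have "p * (p * W (n - 1) z) \<le> W n y"
      using mult_left_mono[of "p * W (n - 1) z" "W (n - 1) (par n y)" p] p_pos by linarith
    then show ?thesis using p_pos by (simp add: field_simps power2_eq_square)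
  qed
  have "sum (W (n - 1)) ?Y \<le> real (card ?Y) * (W n y / p ^ 2)"
    using each by (rule sum_bounded_above)
  also have "\<dots> \<le> 1 / p * (W n y / p ^ 2)"
    using card weight_nonneg[OF y(1)] p_pos by (intro mult_right_mono) auto
  also have "\<dots> = W n y / p ^ 3" by (simp add: power2_eq_square power3_eq_cube)
  finally have "ennreal (sum (W (n - 1)) ?Y) \<le> ennreal (W n y / p ^ 3)"
    by (rule ennreal_leI)
  with mu_cball_le[of x "2 * r" "n - 1"]
  show "\<mu> (cball x (2 * r)) \<le> ennreal (W n y / p ^ 3)" by (rule order_trans)
qed

lemma ex_mu_cball_bounds:
  assumes "0 < r"
  obtains n y where "y \<in> T n" "dist x y < \<delta> powi n" "5 * \<delta> powi n \<le> r" "r < 5 * \<delta> powi (n - 1)"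
    "ennreal (W n y) \<le> \<mu> (cball x r)" "\<mu> (cball x (2 * r)) \<le> ennreal (W n y / p ^ 3)"
  using ex_level[OF assms] covering mu_cball_bounds by (metis (no_types))

lemma mu_cball_pos: "0 < r \<Longrightarrow> 0 < \<mu> (cball x r)"
  using ex_mu_cball_bounds[of r x] W_pos by (metis ennreal_less_zero_iff less_le_trans)

lemma fully_supported_mu: "fully_supported \<mu>"
  unfolding fully_supported_def using mu_cball_pos by blast

lemma measure_on_space_mu: "measure_on_space \<mu>"
  unfolding \<mu>_def
proof (rule measure_on_space_outer_measure_of)
  show "emeasure M (space M) \<noteq> 0"
  proof -
    have "0 < \<mu> (space M)"
      using mu_cball_pos[of 1 b] mu_mono[of "cball b 1" "space M"]
      by (simp add: M_def less_le_trans)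
    then show ?thesis unfolding \<mu>_def outer_measure_of_eq[OF sets.top] by simp
  qed
  fix A :: "'a set" assume "bounded A"
  then obtain x r where "A \<subseteq> cball x r" by (metis bounded_subset_cball)
  then have "outer_measure_of M A \<le> \<mu> (cball x r)" unfolding \<mu>_def by (rule outer_measure_of_mono)
  also have "\<dots> < \<infinity>" using mu_cball_le[of x r 0] by (simp add: le_less_trans)
  finally show "outer_measure_of M A < \<infinity>" .
qed simp

lemma doubling_measure_mu: "doubling_measure \<mu>"
  unfolding doubling_measure_def
proof (intro conjI exI[of _ "1 / p ^ 3"] allI impI)
  show "1 \<le> 1 / p ^ 3"
    using p_pos p_le delta_powr_le_1 power_le_one[of p 3] by simp
  fix x and r :: real assume r: "0 < r"
  show "0 < \<mu> (cball x (2 * r))" using mu_cball_pos r by simp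
  obtain n y where y: "y \<in> T n" "ennreal (W n y) \<le> \<mu> (cball x r)"
    "\<mu> (cball x (2 * r)) \<le> ennreal (W n y / p ^ 3)"
    using ex_mu_cball_bounds[OF r] by metis
  have "ennreal (W n y / p ^ 3) = ennreal (1 / p ^ 3) * ennreal (W n y)"
    using p_pos weight_nonneg[OF y(1)] by (subst ennreal_mult[symmetric]) auto
  also have "\<dots> \<le> ennreal (1 / p ^ 3) * \<mu> (cball x r)"
    using y(2) by (rule mult_left_mono) simp
  finally show "\<mu> (cball x (2 * r)) \<le> ennreal (1 / p ^ 3) * \<mu> (cball x r)" using y(3) by simp
qed (rule measure_on_space_mu)

text \<open>The small ball is bounded above by a node \<open>y\<close> at the level \<open>m\<close>
  of \<open>r\<close>, the large one below by the ancestor of \<open>y\<close> at the level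
  \<open>n\<close> of \<open>R\<close>, and \<open>W_decay\<close> bridges the levels between. The
  constant pays \<open>1 / p ^ 3\<close> for the upper bound and \<open>\<delta> powr (- s)\<close>
  for rounding \<open>R\<close> to a level.\<close>

lemma regularity_mu:
  assumes r: "0 < r" and R: "r < R" "ereal R < ediameter (UNIV :: 'a set)"
  shows "\<mu> (cball x r) / \<mu> (cball x R) \<le> ennreal (\<delta> powr (- s) / p ^ 3 * (r / R) powr s)"
proof -
  obtain m y where y: "y \<in> T m" "dist x y < \<delta> powi m" "5 * \<delta> powi m \<le> r" "r < 5 * \<delta> powi (m - 1)"
    "\<mu> (cball x (2 * r)) \<le> ennreal (W m y / p ^ 3)"
    using ex_mu_cball_bounds[OF r] by metis
  obtain n where n: "5 * \<delta> powi n \<le> R" "R < 5 * \<delta> powi (n - 1)"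
    using ex_level[of R] r R(1) by auto
  \<comment> \<open>Otherwise \<open>m <= n - 1\<close>, and
    \<open>R < 5 * \<delta> powi (n - 1) <= 5 * \<delta> powi m <= r\<close>.\<close>
  have "n \<le> m"
    using scale_antimono[of m "n - 1"] n(2) y(3) R(1) by linarith
  define k where "k = nat (m - n)"
  have k: "m - int k = n" using \<open>n \<le> m\<close> by (simp add: k_def)
  let ?a = "ancestor par k m y"
  have a: "?a \<in> T n" using ancestor_in[OF y(1), of k] k by simp
  have "dist x ?a + 2 * \<delta> powi n \<le> R"
    using ancestor_dist[of y k m] k y(2) n(1) scale_antimono[OF \<open>n \<le> m\<close>] dist_triangle[of x ?a y]
    by simp
  then have lower: "ennreal (W n ?a) \<le> \<mu> (cball x R)" by (rule mu_cball_ge[OF a])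
  have "ereal (\<delta> powi n / 8) \<le> ereal R" using n(1) scale_pos[of n] by simp
  then have "ereal (\<delta> powi (m - int k) / 8) < ediameter (UNIV :: 'a set)"
    using R(2) k by (metis le_less_trans)
  then have "W m y \<le> (\<delta> powr s) ^ k * W n ?a"
    using W_decay[OF y(1), of k] k by simp
  also have "(\<delta> powr s) ^ k \<le> \<delta> powr (- s) * (r / R) powr s"
  proof -
    have "\<delta> ^ k * \<delta> powi n = \<delta> powi m"
      using k delta_pos by (metis add.commute diff_add_cancel less_irrefl power_int_add power_int_of_nat)
    moreover have "\<delta> * R < 5 * \<delta> powi n"
      using n(2) scale_step[of n] delta_pos by (metis mult.left_commute mult_strict_left_mono)
    then have "\<delta> ^ k * (\<delta> * R) \<le> \<delta> ^ k * (5 * \<delta> powi n)"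
      using delta_pos by (intro mult_left_mono) auto
    ultimately have "\<delta> ^ k * (\<delta> * R) \<le> r"
      using y(3) by (simp add: mult.left_commute)
    then have "\<delta> ^ k \<le> 1 / \<delta> * (r / R)" using delta_pos r R(1) by (simp add: field_simps)
    then have "(\<delta> ^ k) powr s \<le> (1 / \<delta> * (r / R)) powr s"
      using delta_pos s_nonneg by (intro powr_mono2) auto
    also have "\<dots> = (1 / \<delta>) powr s * (r / R) powr s"
      using delta_pos r R(1) by (intro powr_mult)
    also have "(1 / \<delta>) powr s = \<delta> powr (- s)"
      using delta_pos by (simp add: powr_minus_divide powr_divide)
    finally show ?thesis using delta_pos
      by (simp add: powr_powr mult.commute flip: powr_realpow)
  qed
  finally have "W m y \<le> \<delta> powr (- s) * (r / R) powr s * W n ?a"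
    using weight_nonneg[OF a] by (simp add: mult_right_mono)
  then have WW: "W m y / p ^ 3 \<le> \<delta> powr (- s) / p ^ 3 * (r / R) powr s * W n ?a"
    using p_pos by (simp add: field_simps)
  have "\<mu> (cball x r) \<le> \<mu> (cball x (2 * r))" using r by (intro mu_mono) auto
  also have "\<dots> \<le> ennreal (\<delta> powr (- s) / p ^ 3 * (r / R) powr s * W n ?a)"
    using y(5) WW by (meson ennreal_leI order_trans)
  also have "\<dots> = ennreal (\<delta> powr (- s) / p ^ 3 * (r / R) powr s) * ennreal (W n ?a)"
    using p_pos weight_nonneg[OF a] by (intro ennreal_mult) auto
  also have "\<dots> \<le> ennreal (\<delta> powr (- s) / p ^ 3 * (r / R) powr s) * \<mu> (cball x R)"
    using lower by (rule mult_left_mono) simp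
  finally have le: "\<mu> (cball x r) \<le> ennreal (\<delta> powr (- s) / p ^ 3 * (r / R) powr s) * \<mu> (cball x R)" .
  show ?thesis
  proof (rule divide_le_posI_ennreal)
    show "0 < \<mu> (cball x R)" using mu_cball_pos r R(1) by simp
    show "\<mu> (cball x r) \<le> \<mu> (cball x R) * ennreal (\<delta> powr (- s) / p ^ 3 * (r / R) powr s)"
      using le by (simp add: mult.commute)
  qed
qed

lemma lower_regularity_dimension_mu: "ereal s \<le> lower_regularity_dimension \<mu>"
proof -
  have "1 \<le> \<delta> powr (- s)"
    using delta_pos delta_powr_le_1 by (simp add: powr_minus field_simps)
  moreover have "1 \<le> 1 / p ^ 3"
    using p_pos p_le delta_powr_le_1 power_le_one[of p 3] by simp
  ultimately have "1 \<le> \<delta> powr (- s) / p ^ 3"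
    using mult_mono[of 1 "\<delta> powr (- s)" 1 "1 / p ^ 3"] by simp
  then show ?thesis
    unfolding lower_regularity_dimension_def using s_nonneg regularity_mu
    by (intro Sup_upper) blast
qed

end

section \<open>Nets and counting in doubling spaces\<close>

text \<open>By Zorn there is a maximal separated set containing \<open>b\<close>; a point at
  distance at least \<open>e\<close> from all of it could be added.\<close>

lemma ex_separated_net:
  fixes b :: "'a::metric_space"
  assumes "0 < e"
  shows "\<exists>S. b \<in> S \<and> (\<forall>x\<in>S. \<forall>y\<in>S. x \<noteq> y \<longrightarrow> e \<le> dist x y) \<and> (\<forall>x. \<exists>y\<in>S. dist x y < e)"
proof -
  let ?A = "{S. b \<in> S \<and> (\<forall>x\<in>S. \<forall>y\<in>S. x \<noteq> y \<longrightarrow> e \<le> dist x y)}"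
  have "\<exists>S\<in>?A. \<forall>X\<in>?A. S \<subseteq> X \<longrightarrow> X = S"
  proof (rule subset_Zorn_nonempty)
    show "?A \<noteq> {}" by (auto intro!: exI[of _ "{b}"])
    fix \<C> assume ne: "\<C> \<noteq> {}" and chain: "subset.chain ?A \<C>"
    have sub: "\<C> \<subseteq> ?A" and total: "\<And>X Y. X \<in> \<C> \<Longrightarrow> Y \<in> \<C> \<Longrightarrow> X \<subseteq> Y \<or> Y \<subseteq> X"
      using chain by (auto simp: subset_chain_def)
    have "e \<le> dist x y" if xy: "x \<in> \<Union>\<C>" "y \<in> \<Union>\<C>" "x \<noteq> y" for x y
    proof -
      obtain X Y where "X \<in> \<C>" "Y \<in> \<C>" "x \<in> X" "y \<in> Y" using xy by blast
      then obtain Z where "Z \<in> \<C>" "x \<in> Z" "y \<in> Z" using total by blast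
      then show ?thesis using sub xy(3) by blast
    qed
    then show "\<Union>\<C> \<in> ?A" using ne sub by blast
  qed
  then obtain S where S: "b \<in> S" "\<And>x y. x \<in> S \<Longrightarrow> y \<in> S \<Longrightarrow> x \<noteq> y \<Longrightarrow> e \<le> dist x y"
    and maximal: "\<And>X. X \<in> ?A \<Longrightarrow> S \<subseteq> X \<Longrightarrow> X = S" by auto
  have "\<exists>y\<in>S. dist x y < e" for x
  proof (rule ccontr)
    assume far: "\<not> (\<exists>y\<in>S. dist x y < e)"
    have "insert x S = S"
      by (rule maximal) (use S far in \<open>auto simp: dist_commute not_less\<close>)
    then show False using far assms by (metis dist_self insertI1)
  qed
  then show ?thesis using S by blast
qed

lemma doubling_iterated_cover:
  fixes x :: "'a::metric_space"
  assumes N: "\<And>(x::'a) r. 0 < r \<Longrightarrow>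
    \<exists>F. finite F \<and> card F \<le> N \<and> covered_by_balls (cball x (2 * r)) r F"
    and "0 < R"
  shows "\<exists>F. finite F \<and> card F \<le> N ^ k \<and> covered_by_balls (cball x R) (R / 2 ^ k) F"
proof (induction k)
  case 0
  show ?case by (rule exI[of _ "{x}"]) (simp add: covered_by_balls_def)
next
  case (Suc k)
  then obtain F where F: "finite F" "card F \<le> N ^ k" "covered_by_balls (cball x R) (R / 2 ^ k) F"
    by blast
  have pos: "0 < R / 2 ^ Suc k" using assms(2) by simp
  have "\<forall>y::'a. \<exists>G. finite G \<and> card G \<le> N \<and>
      covered_by_balls (cball y (R / 2 ^ k)) (R / 2 ^ Suc k) G"
  proof
    show "\<exists>G. finite G \<and> card G \<le> N \<and>
      covered_by_balls (cball y (R / 2 ^ k)) (R / 2 ^ Suc k) G" for y :: 'a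
      using N[OF pos, of y] by simp
  qed
  then obtain G :: "'a \<Rightarrow> 'a set" where G: "\<And>y. finite (G y)" "\<And>y. card (G y) \<le> N"
    "\<And>y. covered_by_balls (cball y (R / 2 ^ k)) (R / 2 ^ Suc k) (G y)"
    unfolding choice_iff by blast
  show ?case
  proof (intro exI[of _ "\<Union>y\<in>F. G y"] conjI)
    show "finite (\<Union>y\<in>F. G y)" using F(1) G(1) by blast
    have "card (\<Union>y\<in>F. G y) \<le> (\<Sum>y\<in>F. card (G y))" by (rule card_UN_le[OF F(1)])
    also have "\<dots> \<le> card F * N" using sum_bounded_above[of F "\<lambda>y. card (G y)" N] G(2) by simp
    also have "\<dots> \<le> N ^ Suc k" using F(2) by (simp add: mult.commute)
    finally show "card (\<Union>y\<in>F. G y) \<le> N ^ Suc k" .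
    show "covered_by_balls (cball x R) (R / 2 ^ Suc k) (\<Union>y\<in>F. G y)"
      using F(3) G(3) unfolding covered_by_balls_def by blast
  qed
qed

text \<open>Two points in one ball of radius \<open>r\<close> are at distance at most
  \<open>2 * r < e\<close>, so choosing a ball for each point of \<open>S\<close> is
  injective.\<close>

lemma card_separated_le_cover:
  fixes S :: "'a::metric_space set"
  assumes sep: "\<And>x y. x \<in> S \<Longrightarrow> y \<in> S \<Longrightarrow> x \<noteq> y \<Longrightarrow> e \<le> dist x y"
    and F: "finite F" "covered_by_balls A r F" and "S \<subseteq> A" "2 * r < e"
  shows "finite S \<and> card S \<le> card F"
proof -
  have "\<forall>y\<in>S. \<exists>z\<in>F. dist z y \<le> r"
    using F(2) assms(4) by (auto simp: covered_by_balls_def subset_iff)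
  then obtain f where f: "\<And>y. y \<in> S \<Longrightarrow> f y \<in> F" "\<And>y. y \<in> S \<Longrightarrow> dist (f y) y \<le> r"
    by metis
  have "inj_on f S"
  proof (rule inj_onI, rule ccontr)
    fix x y assume xy: "x \<in> S" "y \<in> S" "f x = f y" "x \<noteq> y"
    have "dist x y \<le> dist (f x) x + dist (f y) y" using xy(3) by (metis dist_triangle3)
    then show False using f(2)[OF xy(1)] f(2)[OF xy(2)] sep[OF xy(1,2,4)] assms(5) by linarith
  qed
  then show ?thesis
    using f(1) F(1) by (metis card_inj_on_le image_subsetI inj_on_finite)
qed

section \<open>Bounds for the lower dimension\<close>

lemma lower_dimension_nonneg: "0 \<le> lower_dimension TYPE('a::metric_space)"
proof -
  have "1 * (r / R) powr (- 0) \<le> real (card F)"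
    if "0 < r" "r < R" "finite F" "covered_by_balls (cball x R) r F" for r R F and x :: 'a
  proof -
    have "F \<noteq> {}" using that by (auto simp: covered_by_balls_def)
    then show ?thesis using that by (simp add: Suc_le_eq card_gt_0_iff)
  qed
  then have "ereal 0 \<le> lower_dimension TYPE('a)"
    unfolding lower_dimension_def by (intro Sup_upper CollectI exI[of _ 0] conjI exI[of _ 1]) auto
  then show ?thesis by (simp add: zero_ereal_def)
qed

text \<open>Covers by \<open>N ^ k\<close> balls of radius \<open>R / 2 ^ k\<close> rule out every
  exponent above \<open>log 2 N\<close>. Finiteness makes the subtraction of
  \<open>\<epsilon>\<close> a strict decrease.\<close>

lemma lower_dimension_finite:
  assumes N: "\<And>(x::'a::metric_space) r. 0 < r \<Longrightarrow>
    \<exists>F. finite F \<and> card F \<le> N \<and> covered_by_balls (cball x (2 * r)) r F"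
    and "x \<noteq> (y :: 'a)"
  shows "lower_dimension TYPE('a) < \<infinity>"
proof -
  obtain F where "finite F" "card F \<le> N" "covered_by_balls (cball x (2 * 1)) 1 F"
    using N[of 1 x] by auto
  moreover from this(3) have "F \<noteq> {}" by (auto simp: covered_by_balls_def)
  ultimately have N1: "1 \<le> N" by (metis One_nat_def Suc_leI card_gt_0_iff le_trans)
  \<comment> \<open>Half the distance of two distinct points is a radius strictly below the
    diameter, at which the condition on \<open>t\<close> can be tested.\<close>
  define R where "R = dist x y / 2"
  have R: "0 < R" using assms(2) by (simp add: R_def)
  have "ereal (dist x y) \<le> ediameter (UNIV :: 'a set)"
    unfolding ediameter_def by (rule SUP_upper2[of "(x, y)"]) auto
  moreover have "ereal R < ereal (dist x y)" using R by (simp add: R_def)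
  ultimately have diam: "ereal R < ediameter (UNIV :: 'a set)" by (rule less_le_trans[rotated])
  have "t \<le> log 2 N" if c: "0 < c" and
    dim: "\<And>(x::'a) r R F. 0 < r \<Longrightarrow> r < R \<Longrightarrow> ereal R < ediameter (UNIV :: 'a set) \<Longrightarrow> finite F \<Longrightarrow>
      covered_by_balls (cball x R) r F \<Longrightarrow> c * (r / R) powr (- t) \<le> real (card F)" for t c
  proof (rule ccontr)
    assume "\<not> t \<le> log 2 N"
    then have "real N < 2 powr t" using N1 by (simp add: log_le_iff less_powr_iff not_le)
    then obtain k where k: "(real N / 2 powr t) ^ k < c"
      using real_arch_pow_inv[OF c, of "real N / 2 powr t"] by auto
    define q where "q = real N / 2 powr t"
    have q: "0 \<le> q" "q \<le> 1" using \<open>real N < 2 powr t\<close> by (auto simp: q_def)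
    \<comment> \<open>One more halving keeps the small radius strictly below \<open>R\<close>, as
      \<open>dim\<close> demands, even if \<open>k = 0\<close>.\<close>
    have kS: "q ^ Suc k < c"
      using k q mult_left_le_one_le[of "q ^ k" q] by (simp add: q_def[symmetric])
    obtain F where F: "finite F" "card F \<le> N ^ Suc k"
      "covered_by_balls (cball x R) (R / 2 ^ Suc k) F"
      using doubling_iterated_cover[OF N R, of "Suc k" x] by auto
    have lt: "R / 2 ^ Suc k < R"
      using R one_less_power[of "2::real" "Suc k"] by (simp add: divide_less_eq)
    have "c * (R / 2 ^ Suc k / R) powr (- t) \<le> real (card F)"
      by (rule dim[OF _ lt diam F(1,3)]) (use R in simp)
    also have "R / 2 ^ Suc k / R = 2 powr (- real (Suc k))"
      using R by (simp add: powr_minus powr_realpow field_simps del: of_nat_Suc power_Suc)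
    also have "(2 powr (- real (Suc k))) powr (- t) = (2 powr t) ^ Suc k"
      by (simp add: powr_powr mult.commute flip: powr_realpow del: of_nat_Suc power_Suc)
    also have "real (card F) \<le> real N ^ Suc k" using F(2) by (metis of_nat_le_iff of_nat_power)
    finally have "c \<le> q ^ Suc k"
      by (simp add: q_def power_divide pos_le_divide_eq del: power_Suc)
    then show False using kS by simp
  qed
  then have "lower_dimension TYPE('a) \<le> ereal (log 2 N)"
    unfolding lower_dimension_def by (intro Sup_least) auto
  then show ?thesis by (rule le_less_trans) simp
qed

text \<open>The ratio \<open>8 * \<delta>\<close> arises when balls of radius
  \<open>\<delta> powi n\<close> cover one of radius \<open>\<delta> powi (n - 1) / 8\<close>. The
  inequality amounts to \<open>\<delta> powr (t - s) <= c * 8 powr (- t)\<close>, which holds for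
  small \<open>\<delta>\<close> because \<open>s < t\<close>.\<close>

lemma ex_scale:
  fixes t c s :: real
  assumes "0 < c" "s < t"
  shows "\<exists>\<delta>>0. \<delta> \<le> 1 / 100 \<and> \<delta> powr (- s) \<le> c * (8 * \<delta>) powr (- t)"
proof -
  let ?k = "c * 8 powr (- t)"
  let ?\<delta> = "min (1 / 100) (?k powr (1 / (t - s)))"
  have pos: "0 < ?\<delta>" using assms by simp
  have "?\<delta> powr (t - s) \<le> (?k powr (1 / (t - s))) powr (t - s)"
    using pos assms(2) by (intro powr_mono2) auto
  also have "\<dots> = ?k" using assms by (simp add: powr_powr)
  finally have "?\<delta> powr (t - s) * ?\<delta> powr (- t) \<le> ?k * ?\<delta> powr (- t)"
    by (rule mult_right_mono) simp
  moreover have "?\<delta> powr (t - s) * ?\<delta> powr (- t) = ?\<delta> powr (- s)"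
    by (simp flip: powr_add)
  moreover have "(8 * ?\<delta>) powr (- t) = 8 powr (- t) * ?\<delta> powr (- t)"
    using pos by (intro powr_mult)
  ultimately have "?\<delta> powr (- s) \<le> c * (8 * ?\<delta>) powr (- t)" by (simp add: mult.assoc)
  then show ?thesis using pos by (intro exI[of _ ?\<delta>]) auto
qed

section \<open>Realising the hierarchy of nets\<close>

lemma ex_regular_measure:
  fixes t c s \<delta> :: real and b :: "'a::metric_space"
  assumes N: "\<And>(x::'a) r. 0 < r \<Longrightarrow>
    \<exists>F. finite F \<and> card F \<le> N \<and> covered_by_balls (cball x (2 * r)) r F"
    and complete: "complete (UNIV :: 'a set)"
    and dim: "\<And>(x::'a) r R F. 0 < r \<Longrightarrow> r < R \<Longrightarrow> ereal R < ediameter (UNIV :: 'a set) \<Longrightarrow> finite F \<Longrightarrow>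
      covered_by_balls (cball x R) r F \<Longrightarrow> c * (r / R) powr (- t) \<le> real (card F)"
    and s: "0 \<le> s"
    and \<delta>: "0 < \<delta>" "\<delta> \<le> 1 / 100" "\<delta> powr (- s) \<le> c * (8 * \<delta>) powr (- t)"
  shows "\<exists>\<mu> :: 'a set \<Rightarrow> ennreal. doubling_measure \<mu> \<and> fully_supported \<mu> \<and>
    ereal s \<le> lower_regularity_dimension \<mu>"
proof -
  have pos: "0 < \<delta> powi n" for n using \<delta>(1) by simp
  have step: "\<delta> powi n = \<delta> * \<delta> powi (n - 1)" for n
    using power_int_minus_mult[of \<delta> n] \<delta>(1) by (simp add: mult.commute)
  have "\<forall>n. \<exists>S. b \<in> S \<and> (\<forall>x\<in>S. \<forall>y\<in>S. x \<noteq> y \<longrightarrow> \<delta> powi n \<le> dist x y) \<and>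
      (\<forall>x. \<exists>y\<in>S. dist x y < \<delta> powi n)"
    using ex_separated_net[OF pos] by blast
  then obtain T where "\<forall>n. b \<in> T n \<and> (\<forall>x\<in>T n. \<forall>y\<in>T n. x \<noteq> y \<longrightarrow> \<delta> powi n \<le> dist x y) \<and>
      (\<forall>x. \<exists>y\<in>T n. dist x y < \<delta> powi n)"
    unfolding choice_iff by blast
  then have T: "\<And>n. b \<in> T n" "\<And>n x y. x \<in> T n \<Longrightarrow> y \<in> T n \<Longrightarrow> x \<noteq> y \<Longrightarrow> \<delta> powi n \<le> dist x y"
    "\<And>n x. \<exists>y\<in>T n. dist x y < \<delta> powi n" by auto
  have count: "finite {y \<in> T n. dist x y \<le> R} \<and> card {y \<in> T n. dist x y \<le> R} \<le> N ^ k"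
    if R: "0 < R" and k: "2 * (R / 2 ^ k) < \<delta> powi n" for x R n k
  proof -
    obtain F where F: "finite F" "card F \<le> N ^ k" "covered_by_balls (cball x R) (R / 2 ^ k) F"
      using doubling_iterated_cover[OF N R] by blast
    have "finite {y \<in> T n. dist x y \<le> R} \<and> card {y \<in> T n. dist x y \<le> R} \<le> card F"
      by (rule card_separated_le_cover[OF T(2)[of _ n] F(1,3) _ k]) auto
    then show ?thesis using F(2) by linarith
  qed
  have ex_k: "\<exists>k. A / 2 ^ k < e" if "0 < e" for A e :: real
  proof -
    obtain k where "A / e < 2 ^ k" using real_arch_pow[of 2 "A / e"] by auto
    then show ?thesis using that by (intro exI[of _ k]) (simp add: field_simps)
  qed
  \<comment> \<open>24 is twice the radius 12 of \<open>card_local\<close>. Consecutive scales have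
    the constant ratio \<open>\<delta>\<close>, so one \<open>k\<close>, and with it one bound
    \<open>N ^ k\<close>, serves all levels.\<close>
  obtain k where k: "24 / 2 ^ k < \<delta>" using ex_k[OF \<delta>(1)] by blast
  define p where "p = min (\<delta> powr s) (1 / real (N ^ k))"
  have N1: "0 < N"
  proof -
    obtain F where "finite F" "card F \<le> N" "covered_by_balls (cball b (2 * 1)) 1 F"
      using N[of 1 b] by auto
    moreover from this(3) have "F \<noteq> {}" by (auto simp: covered_by_balls_def)
    ultimately show ?thesis by (metis card_gt_0_iff less_le_trans)
  qed
  have net: "net_hierarchy \<delta> s p b T"
  proof
    show "0 < \<delta>" "\<delta> \<le> 1 / 100" "0 \<le> s" by (fact \<delta> s)+
    show "0 < p" using \<delta>(1) N1 by (simp add: p_def)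
    show "p \<le> \<delta> powr s" by (simp add: p_def)
    show "b \<in> T n" for n by (rule T(1))
    show "\<delta> powi n \<le> dist x y" if "x \<in> T n" "y \<in> T n" "x \<noteq> y" for n x y using T(2)[OF that] .
    show "\<exists>y\<in>T n. dist x y < \<delta> powi n" for n x by (rule T(3))
    show "finite {y \<in> T n. dist x y \<le> R}" for n x R
    proof -
      \<comment> \<open>The maximum with 1 supplies the positive radius that \<open>count\<close>
        requires. This \<open>k\<close> may depend on the level, as only finiteness is at
        stake.\<close>
      obtain k where "2 * max R 1 / 2 ^ k < \<delta> powi n" using ex_k[OF pos] by blast
      then have "finite {y \<in> T n. dist x y \<le> max R 1}" using count[of "max R 1" k n x] by simp
      then show ?thesis by (rule rev_finite_subset) auto
    qed
    show "real (card {y \<in> T n. dist x y \<le> 12 * \<delta> powi (n - 1)}) * p \<le> 1" for n x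
    proof -
      have "24 / 2 ^ k * \<delta> powi (n - 1) < \<delta> powi n"
        unfolding step[of n] using k pos by (rule mult_strict_right_mono)
      then have "card {y \<in> T n. dist x y \<le> 12 * \<delta> powi (n - 1)} \<le> N ^ k"
        using count[of "12 * \<delta> powi (n - 1)" k n x] pos[of "n - 1"] by simp
      then have "real (card {y \<in> T n. dist x y \<le> 12 * \<delta> powi (n - 1)}) * p
        \<le> real (N ^ k) * (1 / real (N ^ k))"
        using \<delta>(1) by (intro mult_mono) (auto simp: p_def simp del: of_nat_power)
      then show ?thesis using N1 by simp
    qed
    show "\<delta> powr (- s) \<le> real (card {y \<in> T n. dist y z < \<delta> powi (n - 1) / 4})"
      if "z \<in> T (n - 1)" and diam: "ereal (\<delta> powi (n - 1) / 8) < ediameter (UNIV :: 'a set)" for n z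
    proof -
      let ?F = "{y \<in> T n. dist y z < \<delta> powi (n - 1) / 4}"
      have "\<delta> * \<delta> powi (n - 1) \<le> 1 / 100 * \<delta> powi (n - 1)"
        using \<delta>(2) pos[of "n - 1"] by (intro mult_right_mono) auto
      then have small: "\<delta> powi n \<le> \<delta> powi (n - 1) / 100" using step[of n] by simp
      obtain k where "2 * (\<delta> powi (n - 1)) / 2 ^ k < \<delta> powi n" using ex_k[OF pos] by blast
      then have "finite {y \<in> T n. dist z y \<le> \<delta> powi (n - 1)}"
        using count[of "\<delta> powi (n - 1)" k n z] pos by simp
      then have fin: "finite ?F"
        by (rule rev_finite_subset) (use pos[of "n - 1"] in \<open>auto simp: dist_commute\<close>)
      \<comment> \<open>A point within 1/8 of \<open>z\<close> has a net point within 1/100 of it,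
        hence within 1/4 of \<open>z\<close>: the core covers the smaller ball, and
        \<open>dim\<close> bounds its size from below.\<close>
      have cov: "covered_by_balls (cball z (\<delta> powi (n - 1) / 8)) (\<delta> powi n) ?F"
        unfolding covered_by_balls_def
      proof
        fix x assume x: "x \<in> cball z (\<delta> powi (n - 1) / 8)"
        obtain y where y: "y \<in> T n" "dist x y < \<delta> powi n" using T(3) by blast
        have "dist y z < \<delta> powi (n - 1) / 4"
          using x y(2) small pos[of "n - 1"] dist_triangle3[of y z x] by (simp add: dist_commute)
        then show "x \<in> (\<Union>y\<in>?F. cball y (\<delta> powi n))" using y by (auto simp: dist_commute)
      qed
      have "c * (\<delta> powi n / (\<delta> powi (n - 1) / 8)) powr (- t) \<le> real (card ?F)"
        using pos[of n] pos[of "n - 1"] small by (intro dim[OF _ _ diam fin cov]) auto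
      moreover have "\<delta> powi n / (\<delta> powi (n - 1) / 8) = 8 * \<delta>"
        using pos[of "n - 1"] step[of n] by simp
      ultimately show ?thesis using \<delta>(3) by simp
    qed
    show "complete (UNIV :: 'a set)" by (rule complete)
  qed
  show ?thesis
    using net_hierarchy.doubling_measure_mu[OF net] net_hierarchy.fully_supported_mu[OF net]
      net_hierarchy.lower_regularity_dimension_mu[OF net] by blast
qed

theorem theorem3p4:
  fixes \<epsilon> :: real
  assumes "\<exists>x y :: 'a::metric_space. x \<noteq> y"
    and "uniformly_perfect TYPE('a)"
    and "complete (UNIV :: 'a set)"
    and "doubling_space TYPE('a)"
    and "\<epsilon> > 0"
  shows "\<exists>\<mu> :: 'a set \<Rightarrow> ennreal. doubling_measure \<mu> \<and> fully_supported \<mu> \<and>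
    lower_regularity_dimension \<mu> > lower_dimension TYPE('a) - ereal \<epsilon>"
proof -
  obtain N where N: "\<And>(x::'a) r. 0 < r \<Longrightarrow>
    \<exists>F. finite F \<and> card F \<le> N \<and> covered_by_balls (cball x (2 * r)) r F"
    using assms(4) unfolding doubling_space_def by blast
  obtain x y :: 'a where "x \<noteq> y" using assms(1) by blast
  obtain L where L: "lower_dimension TYPE('a) = ereal L"
    using lower_dimension_finite[OF N \<open>x \<noteq> y\<close>] lower_dimension_nonneg[where 'a = 'a]
    by (cases "lower_dimension TYPE('a)") auto
  have "ereal (L - \<epsilon>) < lower_dimension TYPE('a)" using L assms(5) by simp
  then obtain t c where t: "L - \<epsilon> < t" "0 \<le> t" and c: "0 < c"
    and dim: "\<And>(x::'a) r R F. 0 < r \<Longrightarrow> r < R \<Longrightarrow> ereal R < ediameter (UNIV :: 'a set) \<Longrightarrow> finite F \<Longrightarrow>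
      covered_by_balls (cball x R) r F \<Longrightarrow> c * (r / R) powr (- t) \<le> real (card F)"
    unfolding lower_dimension_def less_Sup_iff by auto
  have "\<exists>s c \<delta>. L - \<epsilon> < s \<and> 0 \<le> s \<and> 0 < \<delta> \<and> \<delta> \<le> 1 / 100 \<and> \<delta> powr (- s) \<le> c * (8 * \<delta>) powr (- t) \<and>
    (\<forall>(x::'a) r R F. 0 < r \<longrightarrow> r < R \<longrightarrow> ereal R < ediameter (UNIV :: 'a set) \<longrightarrow> finite F \<longrightarrow>
      covered_by_balls (cball x R) r F \<longrightarrow> c * (r / R) powr (- t) \<le> real (card F))"
  \<comment> \<open>For \<open>t = 0\<close> there is no \<open>s\<close> with
    \<open>0 <= s < t\<close>. Then \<open>s = 0\<close> exceeds \<open>L - \<epsilon>\<close>, and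
    \<open>c = 1\<close> works because a cover of a ball is nonempty.\<close>
  proof (cases "t = 0")
    case True
    have "1 * (r / R) powr (- t) \<le> real (card F)"
      if "0 < r" "r < R" "finite F" "covered_by_balls (cball x R) r F" for r R F and x :: 'a
    proof -
      have "F \<noteq> {}" using that by (auto simp: covered_by_balls_def)
      then show ?thesis using that True by (simp add: Suc_le_eq card_gt_0_iff)
    qed
    then show ?thesis using True t
      by (intro exI[of _ 0] exI[of _ 1] exI[of _ "1 / 100"]) auto
  next
    case False
    \<comment> \<open>The midpoint of \<open>L - \<epsilon>\<close> and \<open>t\<close>, raised to
      0 if it is negative.\<close>
    define s where "s = max 0 ((t + (L - \<epsilon>)) / 2)"
    have s: "L - \<epsilon> < s" "0 \<le> s" "s < t" using t False by (auto simp: s_def max_def field_simps)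
    show ?thesis using ex_scale[OF c s(3)] s dim by blast
  qed
  then obtain s c \<delta> where s: "L - \<epsilon> < s" "0 \<le> s"
    and \<delta>: "0 < \<delta>" "\<delta> \<le> 1 / 100" "\<delta> powr (- s) \<le> c * (8 * \<delta>) powr (- t)"
    and dim': "\<And>(x::'a) r R F. 0 < r \<Longrightarrow> r < R \<Longrightarrow> ereal R < ediameter (UNIV :: 'a set) \<Longrightarrow> finite F \<Longrightarrow>
      covered_by_balls (cball x R) r F \<Longrightarrow> c * (r / R) powr (- t) \<le> real (card F)"
    by blast
  obtain \<mu> :: "'a set \<Rightarrow> ennreal" where \<mu>: "doubling_measure \<mu>" "fully_supported \<mu>"
    "ereal s \<le> lower_regularity_dimension \<mu>"
    using ex_regular_measure[where N = N and c = c and t = t, OF _ assms(3) _ s(2) \<delta>] N dim' by metis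
  have "lower_dimension TYPE('a) - ereal \<epsilon> < ereal s" using L s(1) by simp
  then show ?thesis using \<mu> less_le_trans by blast
qed

end
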